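(* Let $k\geq 2$ and $s\geq 2$ be integers and let $F_{s,k}$ be the graph obtained from $s$ copies of the cycle $C_{2k+1}$ by letting them share one common edge. Then $f(F_{s,k},n,o(n))=o(n^{\frac{s+2}{s+1}})$. Explicitly, both of the following hold. (a) For every $\beta>0$ there exist $\gamma>0$ and $n_0$ such that for all $n\geq n_0$, every maximal $F_{s,k}$-free graph on $n$ vertices with at least $ex(n,F_{s,k})-\gamma n^{\frac{s+2}{s+1}}$ edges contains an induced complete bipartite subgraph on at least $(1-\beta)n$ vertices. (b) For every $\gamma>0$ there exist $\beta>0$ and $n_0$ such that for all $n\geq n_0$ there is a maximal $F_{s,k}$-free graph on $n$ vertices with at least $ex(n,F_{s,k})-\gamma n^{\frac{s+2}{s+1}}$ edges in which every induced complete bipartite subgraph has at most $(1-\beta)n$ vertices.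
   Context: In $F_{s,k}$ the $s$ cycles pairwise intersect exactly in the two endpoints of the common edge. A graph is $F$-free if it contains no subgraph isomorphic to $F$; it is maximal $F$-free if it is $F$-free and adding any edge of its complement creates a copy of $F$. $ex(n,F)$ is the maximum number of edges in an $F$-free graph on $n$ vertices. For a graph $F$ and integers $n,m$, $f(F,n,m)$ denotes the maximum integer $t$ such that every maximal $F$-free graph on $n$ vertices with at least $ex(n,F)-t$ edges contains an induced complete $(\chi(F)-1)$-partite subgraph on $n-m$ vertices (here $\chi(F_{s,k})=3$, so the subgraph is complete bipartite). The statement $f(F_{s,k},n,o(n))=o(n^{\frac{s+2}{s+1}})$ is understood in the sense of (a) and (b). *)

theory Defs
  imports Complex_Main
begin

type_synonym 'a sgraph = "'a set \<times> 'a set set"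

abbreviation verts :: "'a sgraph \<Rightarrow> 'a set" where
  "verts G \<equiv> fst G"

abbreviation edges :: "'a sgraph \<Rightarrow> 'a set set" where
  "edges G \<equiv> snd G"

definition simple_graph :: "'a sgraph \<Rightarrow> bool" where
  "simple_graph G \<longleftrightarrow> finite (verts G) \<and> (\<forall>e\<in>edges G. e \<subseteq> verts G \<and> card e = 2)"

text \<open>Vertices are drawn from the natural numbers, which loses no generality since every
  finite graph is isomorphic to one of these.\<close>

definition graph_on :: "nat \<Rightarrow> nat sgraph \<Rightarrow> bool" where
  "graph_on n G \<longleftrightarrow> simple_graph G \<and> card (verts G) = n"

text \<open>The copy of \<open>F\<close> in \<open>G\<close> need not be induced.\<close>

definition contains_copy :: "'b sgraph \<Rightarrow> 'a sgraph \<Rightarrow> bool" where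
  "contains_copy F G \<longleftrightarrow>
     (\<exists>h. inj_on h (verts F) \<and> h ` verts F \<subseteq> verts G \<and> (\<forall>e\<in>edges F. h ` e \<in> edges G))"

definition F_free :: "'b sgraph \<Rightarrow> 'a sgraph \<Rightarrow> bool" where
  "F_free F G \<longleftrightarrow> \<not> contains_copy F G"

definition add_edge :: "'a set \<Rightarrow> 'a sgraph \<Rightarrow> 'a sgraph" where
  "add_edge e G = (verts G, insert e (edges G))"

definition maximal_F_free :: "'b sgraph \<Rightarrow> 'a sgraph \<Rightarrow> bool" where
  "maximal_F_free F G \<longleftrightarrow>
     F_free F G \<and>
     (\<forall>u\<in>verts G. \<forall>v\<in>verts G. u \<noteq> v \<longrightarrow> {u, v} \<notin> edges G \<longrightarrow>
        contains_copy F (add_edge {u, v} G))"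

text \<open>The maximum is over a finite set, and it is nonempty as soon as \<open>F\<close> has an edge.\<close>

definition ex_number :: "nat \<Rightarrow> 'b sgraph \<Rightarrow> nat" where
  "ex_number n F = Max {card (edges G) | G. graph_on n G \<and> F_free F G}"

definition induced :: "'a sgraph \<Rightarrow> 'a set \<Rightarrow> 'a sgraph" where
  "induced G S = (S, {e \<in> edges G. e \<subseteq> S})"

definition complete_bipartite :: "'a sgraph \<Rightarrow> bool" where
  "complete_bipartite G \<longleftrightarrow>
     (\<exists>A B. A \<noteq> {} \<and> B \<noteq> {} \<and> A \<inter> B = {} \<and> verts G = A \<union> B \<and>
            edges G = {{a, b} | a b. a \<in> A \<and> b \<in> B})"

definition cycle_graph :: "nat \<Rightarrow> nat sgraph" where
  "cycle_graph m = ({..<m}, {{j, Suc j mod m} | j. j < m})"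

text \<open>Vertex \<open>j\<close> of the \<open>i\<close>-th cycle becomes \<open>(i, j)\<close>, except that the
  endpoints \<open>0\<close> and \<open>1\<close> of the shared edge are identified across all the cycles.\<close>

definition glue :: "nat \<Rightarrow> nat \<Rightarrow> nat \<times> nat" where
  "glue i j = (if j \<le> 1 then (0, j) else (i, j))"

definition F_graph :: "nat \<Rightarrow> nat \<Rightarrow> (nat \<times> nat) sgraph" where
  "F_graph s k =
     (\<Union>i<s. glue i ` verts (cycle_graph (2 * k + 1)),
      \<Union>i<s. (\<lambda>e. glue i ` e) ` edges (cycle_graph (2 * k + 1)))"

end

theory Submission
  imports Defs "HOL-Library.Countable" "HOL-Analysis.Convex"
begin

text \<open>
  The graph \<open>F = F\<^sub>s\<^sub>,\<^sub>k\<close> becomes bipartite when its shared edge is removed, and deleting vertices of low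
  degree reduces questions about its Turan number to \<open>F\<close>-free graphs of minimum degree at least \<open>0.49 n\<close>.
  In such a graph any three vertices include two with linearly many common neighbours, so long even
  paths between the ends of an edge abound unless the neighbourhoods of the two ends almost partition
  the vertices; this forces the graph to be bipartite. Hence \<open>ex(n, F) = \<lfloor>n\<^sup>2/4\<rfloor>\<close> for large \<open>n\<close>, and a graph
  with \<open>n\<^sup>2/4 - \<gamma> n p\<close> edges, \<open>p = n\<^bsup>1/(s+1)\<^esup>\<close>, becomes bipartite with \<open>O(\<gamma> n p)\<close> missing edges after the removal of
  a set \<open>L\<close> of \<open>O(\<gamma> p)\<close> vertices.

  For (a), each missing edge \<open>ab\<close> creates a copy of \<open>F\<close> in which every cycle, being odd, meets \<open>L\<close>. One
  vertex of \<open>L\<close> on each cycle already separates \<open>a\<close> from \<open>b\<close> in the copy minus \<open>ab\<close>, so copies that agree on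
  these \<open>s\<close> vertices can be spliced. There are only \<open>O(|L|\<^bsup>s\<^esup>)\<close> such choices, so a linear matching of
  missing edges would produce too many missing edges.

  For (b), attach to the two sides of a balanced complete bipartite graph \<open>s t\<close> paths with \<open>2k - 1\<close>
  vertices, indexed by a coordinate \<open>i < s\<close> and a digit \<open>j < t\<close>, where \<open>t\<close> is a small multiple of \<open>p\<close>. A
  small proportion of the vertices on either side carries \<open>s\<close> digits and is joined to the \<open>s\<close> paths
  they select, and vertices on opposite sides with the same digits are nonadjacent.
\<close>

section \<open>Copies of \<open>F\<close>\<close>

definition nbh :: "'a sgraph \<Rightarrow> 'a \<Rightarrow> 'a set" where
  "nbh G v = {w. {v, w} \<in> edges G}"

lemma edge_verts:
  assumes "simple_graph G" "{u, v} \<in> edges G"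
  shows "u \<in> verts G" "v \<in> verts G" "u \<noteq> v"
  using assms unfolding simple_graph_def by (force simp: card_insert_if)+

lemma nbh_subset: "simple_graph G \<Longrightarrow> nbh G v \<subseteq> verts G"
  by (auto simp: nbh_def dest: edge_verts)

lemma finite_nbh: "simple_graph G \<Longrightarrow> finite (nbh G v)"
  by (meson finite_subset nbh_subset simple_graph_def)

lemma finite_edges: "simple_graph G \<Longrightarrow> finite (edges G)"
  unfolding simple_graph_def by (meson PowI finite_Pow_iff finite_subset subsetI)

lemma edgeE:
  assumes "simple_graph G" "e \<in> edges G"
  obtains u v where "e = {u, v}" "u \<noteq> v" "u \<in> verts G" "v \<in> verts G"
proof -
  have "card e = 2" "e \<subseteq> verts G" using assms by (auto simp: simple_graph_def)
  then obtain u v where "e = {u, v}" "u \<noteq> v" by (auto simp: card_2_iff)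
  with \<open>e \<subseteq> verts G\<close> that show thesis by auto
qed

lemma glue_eq_iff: "glue i j = glue i' j' \<longleftrightarrow> j = j' \<and> (j \<le> 1 \<or> i = i')"
  by (auto simp: glue_def)

lemma verts_F_graph: "verts (F_graph s k) = {glue i j | i j. i < s \<and> j < 2 * k + 1}"
  by (auto simp: F_graph_def cycle_graph_def)

lemma edges_F_graph:
  "edges (F_graph s k) = {{glue i j, glue i (Suc j mod (2 * k + 1))} | i j. i < s \<and> j < 2 * k + 1}"
  (is "?L = ?R")
proof (rule set_eqI)
  fix e
  have "e \<in> ?L \<longleftrightarrow> (\<exists>i<s. \<exists>j<2*k+1. e = glue i ` {j, Suc j mod (2 * k + 1)})"
    unfolding F_graph_def cycle_graph_def by (simp, blast)
  then show "e \<in> ?L \<longleftrightarrow> e \<in> ?R" by auto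
qed

lemma finite_verts_F_graph: "finite (verts (F_graph s k))"
  by (simp add: F_graph_def cycle_graph_def)

text \<open>Injectivity is demanded modulo \<open>glue\<close>, because positions \<open>0\<close>
  and \<open>1\<close> of all the cycles name the same two vertices.\<close>

lemma contains_copyI:
  assumes "\<And>i j. i < s \<Longrightarrow> j < 2*k+1 \<Longrightarrow> h (glue i j) \<in> verts G"
    and "\<And>i j i' j'. i < s \<Longrightarrow> j < 2*k+1 \<Longrightarrow> i' < s \<Longrightarrow> j' < 2*k+1 \<Longrightarrow>
          h (glue i j) = h (glue i' j') \<Longrightarrow> glue i j = glue i' j'"
    and "\<And>i j. i < s \<Longrightarrow> j < 2*k+1 \<Longrightarrow> {h (glue i j), h (glue i (Suc j mod (2*k+1)))} \<in> edges G"
  shows "contains_copy (F_graph s k) G"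
  unfolding contains_copy_def
proof (intro exI conjI)
  show "inj_on h (verts (F_graph s k))"
    unfolding inj_on_def verts_F_graph using assms(2) by blast
  show "h ` verts (F_graph s k) \<subseteq> verts G"
    unfolding verts_F_graph using assms(1) by blast
  show "\<forall>e\<in>edges (F_graph s k). h ` e \<in> edges G"
    unfolding edges_F_graph using assms(3) by auto
qed

lemma contains_copyE:
  assumes "contains_copy (F_graph s k) G"
  obtains h where "\<And>i j. i < s \<Longrightarrow> j < 2*k+1 \<Longrightarrow> h (glue i j) \<in> verts G"
    and "\<And>i j i' j'. i < s \<Longrightarrow> j < 2*k+1 \<Longrightarrow> i' < s \<Longrightarrow> j' < 2*k+1 \<Longrightarrow>
          h (glue i j) = h (glue i' j') \<Longrightarrow> glue i j = glue i' j'"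
    and "\<And>i j. i < s \<Longrightarrow> j < 2*k+1 \<Longrightarrow> {h (glue i j), h (glue i (Suc j mod (2*k+1)))} \<in> edges G"
proof -
  obtain h where h: "inj_on h (verts (F_graph s k))" "h ` verts (F_graph s k) \<subseteq> verts G"
    "\<forall>e\<in>edges (F_graph s k). h ` e \<in> edges G"
    using assms unfolding contains_copy_def by blast
  show thesis
  proof (rule that)
    fix i j assume "i < s" "j < 2*k+1"
    then show "h (glue i j) \<in> verts G"
      using h(2) unfolding verts_F_graph by blast
    have "{glue i j, glue i (Suc j mod (2 * k + 1))} \<in> edges (F_graph s k)"
      unfolding edges_F_graph using \<open>i < s\<close> \<open>j < 2*k+1\<close> by blast
    then show "{h (glue i j), h (glue i (Suc j mod (2*k+1)))} \<in> edges G"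
      using h(3) by fastforce
  next
    fix i j i' j' assume "i < s" "j < 2*k+1" "i' < s" "j' < 2*k+1" "h (glue i j) = h (glue i' j')"
    then show "glue i j = glue i' j'"
      using h(1) unfolding inj_on_def verts_F_graph by blast
  qed
qed

text \<open>Without the shared edge \<open>uv\<close> the cycles become internally disjoint paths of
  length \<open>2 * k\<close> from \<open>v\<close> to \<open>u\<close>, each with
  \<open>2 * k - 1\<close> inner vertices.\<close>

lemma contains_copy_of_paths:
  assumes k: "k \<ge> 1" and "u \<noteq> v" "u \<in> verts G" "v \<in> verts G" and uv: "{u, v} \<in> edges G"
    and P: "\<And>i. i < s \<Longrightarrow> length (P i) = 2 * k - 1 \<and> distinct (P i) \<and>
              set (P i) \<subseteq> verts G - {u, v} \<and> successively (\<lambda>x y. {x, y} \<in> edges G) (v # P i @ [u])"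
    and disj: "\<And>i i'. i < s \<Longrightarrow> i' < s \<Longrightarrow> i \<noteq> i' \<Longrightarrow> set (P i) \<inter> set (P i') = {}"
  shows "contains_copy (F_graph s k) G"
proof -
  \<comment> \<open>Every cycle is listed from the shared edge on, so \<open>C i ! 0\<close> and
    \<open>C i ! 1\<close> do not depend on \<open>i\<close> and \<open>h\<close> is compatible with
    \<open>glue\<close>.\<close>
  define C where "C i = u # v # P i" for i
  define h where "h = (\<lambda>(i, j). C i ! j)"
  have h: "h (glue i j) = C i ! j" for i j
    by (auto simp: h_def glue_def C_def nth_Cons' le_Suc_eq)
  have lenC: "length (C i) = 2 * k + 1" if "i < s" for i
    using P[OF that] k by (simp add: C_def)
  have distC: "distinct (C i)" if "i < s" for i
    using P[OF that] \<open>u \<noteq> v\<close> by (auto simp: C_def)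
  show ?thesis
  proof (rule contains_copyI[where h = h])
    fix i j assume i: "i < s" and j: "j < 2 * k + 1"
    have "C i ! j \<in> set (C i)" using lenC[OF i] j by simp
    also have "set (C i) \<subseteq> verts G" using P[OF i] assms(3,4) by (auto simp: C_def)
    finally show "h (glue i j) \<in> verts G" by (simp add: h)
    \<comment> \<open>Appending \<open>u\<close> closes the cycle: index \<open>2 * k + 1\<close> of
      the longer list stands for position \<open>0\<close>.\<close>
    have succ: "successively (\<lambda>x y. {x, y} \<in> edges G) (C i @ [u])"
      using P[OF i] uv by (simp add: C_def)
    have "{(C i @ [u]) ! j, (C i @ [u]) ! Suc j} \<in> edges G"
      using successively_conv_nth[THEN iffD1, OF succ] j lenC[OF i] by auto
    moreover have "(C i @ [u]) ! j = C i ! j" using j lenC[OF i] by (simp add: nth_append)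
    moreover have "(C i @ [u]) ! Suc j = C i ! (Suc j mod (2 * k + 1))"
    proof (cases "Suc j < 2 * k + 1")
      case True then show ?thesis using lenC[OF i] by (simp add: nth_append)
    next
      case False
      then have "Suc j = 2 * k + 1" using j by simp
      then have "Suc j mod (2 * k + 1) = 0" "(C i @ [u]) ! Suc j = u"
        using lenC[OF i] by (simp_all add: nth_append)
      then show ?thesis by (simp add: C_def)
    qed
    ultimately show "{h (glue i j), h (glue i (Suc j mod (2*k+1)))} \<in> edges G"
      by (simp add: h)
  next
    fix i j i' j' assume i: "i < s" "j < 2*k+1" "i' < s" "j' < 2*k+1"
      and eq: "h (glue i j) = h (glue i' j')"
    show "glue i j = glue i' j'"
    proof (cases "i = i'")
      case True
      then show ?thesis using eq i distC[of i] lenC[of i] by (simp add: h nth_eq_iff_index_eq)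
    next
      case False
      have mem: "C i ! j \<in> set (P i)" if "j \<ge> 2" "i < s" "j < 2*k+1" for i j
        using that P[of i] by (auto simp: C_def nth_Cons' intro!: nth_mem)
      have eqC: "C i ! j = C i' ! j'" using eq by (simp add: h)
      have low: "C i ! j = C i' ! j" if "j < 2" for i i' j
        using that by (auto simp: C_def less_2_cases_iff)
      \<comment> \<open>An end of the shared edge lies on both cycles at the same position, and
        distinctness along one cycle gives \<open>j = j'\<close>. If neither vertex is such an end,
        disjointness of the paths excludes the case.\<close>
      consider "j < 2" | "j' < 2" | "j \<ge> 2" "j' \<ge> 2" by linarith
      then have "j = j' \<and> j < 2"
      proof cases
        case 1
        then have "C i' ! j = C i' ! j'" using low eqC by metis
        then show ?thesis using distC[of i'] lenC[of i'] i 1 by (simp add: nth_eq_iff_index_eq)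
      next
        case 2
        then have "C i ! j = C i ! j'" using low eqC by metis
        then show ?thesis using distC[of i] lenC[of i] i 2 by (simp add: nth_eq_iff_index_eq)
      next
        case 3
        then show ?thesis using mem[of j i] mem[of j' i'] i disj[of i i'] False eqC by auto
      qed
      then show ?thesis by (simp add: glue_eq_iff)
    qed
  qed
qed

section \<open>Graphs of large minimum degree\<close>

definition bipartition :: "'a sgraph \<Rightarrow> 'a set \<Rightarrow> 'a set \<Rightarrow> bool" where
  "bipartition G A B \<longleftrightarrow> A \<union> B = verts G \<and> A \<inter> B = {} \<and> (\<forall>e\<in>edges G. \<exists>a\<in>A. \<exists>b\<in>B. e = {a, b})"

definition rich :: "'a sgraph \<Rightarrow> 'a \<Rightarrow> 'a \<Rightarrow> bool" where
  "rich G x y \<longleftrightarrow> card (verts G) \<le> 10 * card (nbh G x \<inter> nbh G y)"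

lemma rich_sym: "rich G x y \<longleftrightarrow> rich G y x"
  by (simp add: rich_def Int_commute)

lemma card_Un3_ge:
  assumes "finite A" "finite B" "finite C"
  shows "card A + card B + card C \<le>
    card (A \<union> B \<union> C) + card (A \<inter> B) + card (A \<inter> C) + card (B \<inter> C)"
proof -
  have "card A + card B = card (A \<union> B) + card (A \<inter> B)"
    using assms by (intro card_Un_Int) auto
  moreover have "card (A \<union> B) + card C = card (A \<union> B \<union> C) + card ((A \<union> B) \<inter> C)"
    using assms by (intro card_Un_Int) auto
  moreover have "card ((A \<union> B) \<inter> C) \<le> card (A \<inter> C) + card (B \<inter> C)"
    unfolding Int_Un_distrib2 by (rule card_Un_le)
  ultimately show ?thesis by linarith
qed

locale dense_graph =
  fixes G :: "'a sgraph"
  assumes simple: "simple_graph G"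
    and min_degree: "\<And>v. v \<in> verts G \<Longrightarrow> 49 * card (verts G) \<le> 100 * card (nbh G v)"
begin

lemma fin_nbh: "finite (nbh G v)"
  using simple by (rule finite_nbh)

lemma nbh_verts: "nbh G v \<subseteq> verts G"
  using simple by (rule nbh_subset)

lemma fin_verts: "finite (verts G)"
  using simple by (simp add: simple_graph_def)

text \<open>Three neighbourhoods of size at least \<open>0.49 n\<close> have total size at least
  \<open>1.47 n\<close>, so their pairwise intersections add up to at least \<open>0.47 n\<close>,
  more than three times the \<open>n / 10\<close> of \<open>rich\<close>.\<close>

lemma rich_of_three:
  assumes "x \<in> verts G" "y \<in> verts G" "z \<in> verts G"
  shows "rich G x y \<or> rich G x z \<or> rich G y z"
proof -
  have "card (nbh G x \<union> nbh G y \<union> nbh G z) \<le> card (verts G)"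
    by (intro card_mono fin_verts) (use nbh_verts in blast)
  then show ?thesis
    unfolding rich_def
    using card_Un3_ge[OF fin_nbh fin_nbh fin_nbh, of x y z] assms[THEN min_degree] by linarith
qed

text \<open>Among three common neighbours of \<open>x\<close> and \<open>z\<close> two form a rich
  pair again; they become the outermost inner vertices, and recursion joins them. \<open>T\<close>
  has to contain \<open>x\<close> and \<open>z\<close> if the inner vertices are to avoid
  them.\<close>

lemma rich_path:
  assumes "rich G x z" "finite T" "10 * (card T + 2 * j + 3) \<le> card (verts G)"
  shows "\<exists>ws. length ws = 2 * j + 1 \<and> distinct ws \<and> set ws \<inter> T = {} \<and> set ws \<subseteq> verts G \<and>
    successively (\<lambda>x y. {x, y} \<in> edges G) (x # ws @ [z])"
  using assms
proof (induction j arbitrary: x z T)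
  case 0
  have "card (nbh G x \<inter> nbh G z) \<le> card (nbh G x \<inter> nbh G z - T) + card T"
    using 0 by (metis diff_card_le_card_Diff le_diff_conv)
  then have "3 \<le> card (nbh G x \<inter> nbh G z - T)"
    using 0 unfolding rich_def by simp
  then have "nbh G x \<inter> nbh G z - T \<noteq> {}" by (metis card.empty not_numeral_le_zero)
  then obtain y where "y \<in> nbh G x" "y \<in> nbh G z" "y \<notin> T" by blast
  then show ?case
    using nbh_verts by (intro exI[of _ "[y]"]) (auto simp: nbh_def insert_commute)
next
  case (Suc j)
  have "card (nbh G x \<inter> nbh G z) \<le> card (nbh G x \<inter> nbh G z - T) + card T"
    using Suc by (metis diff_card_le_card_Diff le_diff_conv)
  then have "3 \<le> card (nbh G x \<inter> nbh G z - T)"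
    using Suc.prems unfolding rich_def by simp
  then obtain S where S: "S \<subseteq> nbh G x \<inter> nbh G z - T" "card S = 3"
    by (meson obtain_subset_with_card_n)
  then obtain a b c where abc: "S = {a, b, c}" "a \<noteq> b" "a \<noteq> c" "b \<noteq> c"
    by (auto simp: card_3_iff)
  have "rich G a b \<or> rich G a c \<or> rich G b c"
  proof (rule rich_of_three)
    have "{a, b, c} \<subseteq> verts G" using S(1) abc(1) nbh_verts[of x] by blast
    then show "a \<in> verts G" "b \<in> verts G" "c \<in> verts G" by auto
  qed
  then obtain y y' where y: "rich G y y'" "y \<noteq> y'" "y \<in> S" "y' \<in> S"
    using abc that[of a b] that[of a c] that[of b c] by auto
  \<comment> \<open>The budget \<open>card T + 2 * j + 3\<close> does not grow in the recursive
    call: at most two vertices enter \<open>T\<close> while \<open>j\<close> drops by one.\<close>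
  have "card (insert y (insert y' T)) \<le> card T + 2"
    using card_insert_le_m1 Suc.prems(2) by (simp add: card_insert_if)
  then obtain ws where ws: "length ws = 2 * j + 1" "distinct ws" "set ws \<inter> insert y (insert y' T) = {}"
      "set ws \<subseteq> verts G" "successively (\<lambda>x y. {x, y} \<in> edges G) (y # ws @ [y'])"
    using Suc.IH[OF y(1), of "insert y (insert y' T)"] Suc.prems by auto
  have "{x, y} \<in> edges G" "{y', z} \<in> edges G" "y \<notin> T" "y' \<notin> T"
    using y S by (auto simp: nbh_def insert_commute)
  moreover have "y \<in> verts G" "y' \<in> verts G"
    using y(3,4) S(1) nbh_verts[of x] by blast+
  ultimately show ?case
    using ws y(2)
    by (intro exI[of _ "y # ws @ [y']"]) (auto simp: successively_append_iff successively_Cons hd_append)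
qed

text \<open>Otherwise \<open>s\<close> disjoint paths from \<open>v\<close> to \<open>u\<close> can
  be chosen greedily, with \<open>T\<close> the set of vertices used so far: a rich pair in the two
  neighbourhoods outside \<open>T\<close> is joined by \<open>rich_path\<close>.\<close>

lemma ex_obstruction:
  assumes free: "\<not> contains_copy (F_graph s k) G" and k: "k \<ge> 2"
    and uv: "{u, v} \<in> edges G"
    and large: "10 * (2 * k * s + 2 * k + 10) \<le> card (verts G)"
  shows "\<exists>T. finite T \<and> card T \<le> 2 * k * s + 2 \<and>
    (\<forall>x\<in>nbh G u - T. \<forall>z\<in>nbh G v - T. x \<noteq> z \<longrightarrow> \<not> rich G x z)"
proof (rule ccontr)
  assume "\<not> ?thesis"
  then have ex: "\<exists>x\<in>nbh G u - T. \<exists>z\<in>nbh G v - T. x \<noteq> z \<and> rich G x z"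
    if "finite T" "card T \<le> 2 * k * s + 2" for T
    using that by blast
  have u: "u \<in> verts G" "v \<in> verts G" "u \<noteq> v"
    using edge_verts[OF simple uv] by auto
  let ?ok = "\<lambda>xs. length xs = 2 * k - 1 \<and> distinct xs \<and>
      set xs \<subseteq> verts G - {u, v} \<and> successively (\<lambda>x y. {x, y} \<in> edges G) (v # xs @ [u])"
  have "\<exists>P. (\<forall>i<r. ?ok (P i)) \<and> (\<forall>i<r. \<forall>i'<r. i \<noteq> i' \<longrightarrow> set (P i) \<inter> set (P i') = {})"
    if "r \<le> s" for r
    using that
  proof (induction r)
    case 0
    then show ?case by simp
  next
    case (Suc r)
    then obtain P where P: "\<forall>i<r. ?ok (P i)"
        "\<forall>i<r. \<forall>i'<r. i \<noteq> i' \<longrightarrow> set (P i) \<inter> set (P i') = {}"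
      by auto
    define T where "T = {u, v} \<union> (\<Union>i<r. set (P i))"
    have "card (\<Union>i<r. set (P i)) \<le> (\<Sum>i<r. card (set (P i)))"
      by (rule card_UN_le) simp
    also have "\<dots> \<le> (\<Sum>i<r. 2 * k)"
      by (intro sum_mono) (use P(1) card_length in \<open>auto intro: le_trans[OF card_length]\<close>)
    also have "\<dots> \<le> 2 * k * s" using Suc.prems by simp
    finally have "card T \<le> 2 * k * s + 2"
      unfolding T_def using card_Un_le[of "{u, v}" "\<Union>i<r. set (P i)"] u(3) by simp
    moreover have "finite T" by (simp add: T_def)
    ultimately obtain x z where xz: "x \<in> nbh G u" "x \<notin> T" "z \<in> nbh G v" "z \<notin> T" "x \<noteq> z" "rich G z x"
      using ex[of T] rich_sym by (metis Diff_iff)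
    have "card (insert x (insert z T)) \<le> card T + 2"
      using \<open>finite T\<close> by (simp add: card_insert_if)
    then have "10 * (card (insert x (insert z T)) + 2 * (k - 2) + 3) \<le> card (verts G)"
      using large k \<open>card T \<le> _\<close> by (simp add: algebra_simps)
    \<comment> \<open>With \<open>z\<close> and \<open>x\<close> at its ends the list has
      \<open>2 * (k - 2) + 1 + 2 = 2 * k - 1\<close> vertices.\<close>
    then obtain ws where ws: "length ws = 2 * (k - 2) + 1" "distinct ws"
        "set ws \<inter> insert x (insert z T) = {}" "set ws \<subseteq> verts G"
        "successively (\<lambda>x y. {x, y} \<in> edges G) (z # ws @ [x])"
      using rich_path[OF xz(6), of "insert x (insert z T)" "k - 2"] \<open>finite T\<close> by auto
    have new: "?ok (z # ws @ [x])" "set (z # ws @ [x]) \<inter> T = {}"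
      using ws xz k nbh_verts unfolding T_def
      by (auto simp: nbh_def insert_commute successively_append_iff successively_Cons hd_append)
    show ?case
    proof (rule exI[of _ "P(r := z # ws @ [x])"], rule conjI)
      show "\<forall>i<Suc r. ?ok ((P(r := z # ws @ [x])) i)"
        using new(1) P(1) by (metis (no_types, lifting) fun_upd_other fun_upd_same less_Suc_eq)
      have *: "set (z # ws @ [x]) \<inter> set (P i) = {}" if "i < r" for i
        using that new(2) unfolding T_def by blast
      show "\<forall>i<Suc r. \<forall>i'<Suc r. i \<noteq> i' \<longrightarrow>
          set ((P(r := z # ws @ [x])) i) \<inter> set ((P(r := z # ws @ [x])) i') = {}"
      proof (intro allI impI)
        fix i i' assume i: "i < Suc r" "i' < Suc r" "i \<noteq> i'"
        consider "i = r" "i' < r" | "i < r" "i' = r" | "i < r" "i' < r" using i by linarith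
        then show "set ((P(r := z # ws @ [x])) i) \<inter> set ((P(r := z # ws @ [x])) i') = {}"
          using i P(2) *[of i] *[of i'] by cases (simp_all add: Int_commute)
      qed
    qed
  qed
  from this[of s] obtain P where P: "\<forall>i<s. ?ok (P i)"
      "\<forall>i<s. \<forall>i'<s. i \<noteq> i' \<longrightarrow> set (P i) \<inter> set (P i') = {}"
    by auto
  have "contains_copy (F_graph s k) G"
    by (rule contains_copy_of_paths[where u = u and v = v and P = P]) (use u uv k P in auto)
  then show False using free by simp
qed

text \<open>For a single edge \<open>uv\<close>, the neighbourhoods of its ends outside an
  obstruction nearly form a bipartition. Ends of an edge have few common neighbours and are never
  rich, whereas two vertices of the same neighbourhood are rich, since neither is rich with a vertex
  of the other one. Every remaining vertex is then forced to one side.\<close>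

lemma ex_bipartition:
  assumes free: "\<not> contains_copy (F_graph s k) G" and k: "k \<ge> 2"
    and large: "100 * (2 * k * s + 2 * k + 10) \<le> card (verts G)"
  shows "\<exists>A B. bipartition G A B"
proof -
  define n where "n = card (verts G)"
  define K where "K = 2 * k * s + 2"
  have nK: "100 * K \<le> n" "n \<ge> 1000" using large by (auto simp: n_def K_def)
  have deg: "49 * n \<le> 100 * card (nbh G v)" if "v \<in> verts G" for v
    using min_degree[OF that] by (simp add: n_def)
  have obs: "\<exists>T. finite T \<and> card T \<le> K \<and> nbh G u \<inter> nbh G v \<subseteq> T \<and>
    (\<forall>x\<in>nbh G u - T. \<forall>z\<in>nbh G v - T. \<not> rich G x z)" if uv: "{u, v} \<in> edges G" for u v
  proof -
    obtain T where T: "finite T" "card T \<le> K"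
      "\<forall>x\<in>nbh G u - T. \<forall>z\<in>nbh G v - T. x \<noteq> z \<longrightarrow> \<not> rich G x z"
      using ex_obstruction[OF free k uv] large unfolding K_def by fastforce
    \<comment> \<open>A common neighbour \<open>x\<close> outside \<open>T\<close>, some
      \<open>y\<close> near \<open>u\<close> and some \<open>z\<close> near \<open>v\<close> would
      be three vertices without a rich pair, because \<open>x\<close> counts on both sides.\<close>
    have "nbh G u \<inter> nbh G v \<subseteq> T"
    proof
      fix x assume x: "x \<in> nbh G u \<inter> nbh G v"
      show "x \<in> T"
      proof (rule ccontr)
        assume "x \<notin> T"
        have *: "card (nbh G w - S) > 0" if "w \<in> verts G" "finite S" "card S \<le> K + 2" for w S
          using deg[OF that(1)] that(2,3) diff_card_le_card_Diff[OF that(2), of "nbh G w"] nK by linarith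
        have uv': "u \<in> verts G" "v \<in> verts G" using edge_verts[OF simple uv] by auto
        have "card (insert x T) \<le> K + 2"
          using T by (simp add: card_insert_if)
        then obtain y where y: "y \<in> nbh G u" "y \<notin> T" "y \<noteq> x"
          using *[OF uv'(1), of "insert x T"] T(1) by (auto simp: card_gt_0_iff)
        have "card (insert y (insert x T)) \<le> K + 2"
          using T by (simp add: card_insert_if)
        then obtain z where z: "z \<in> nbh G v" "z \<notin> T" "z \<noteq> x" "z \<noteq> y"
          using *[OF uv'(2), of "insert y (insert x T)"] T(1) by (auto simp: card_gt_0_iff)
        have "\<not> rich G y x" "\<not> rich G x z" "\<not> rich G y z"
          using T(3) x y z \<open>x \<notin> T\<close> by auto
        then show False
          using rich_of_three[of y x z] x y(1) z(1) nbh_verts[of u] nbh_verts[of v] by auto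
      qed
    qed
    moreover from this have "\<forall>x\<in>nbh G u - T. \<forall>z\<in>nbh G v - T. \<not> rich G x z"
      using T(3) by (metis Diff_iff IntI subsetD)
    ultimately show ?thesis using T by blast
  qed
  have codeg: "card (nbh G u \<inter> nbh G v) \<le> K" if "{u, v} \<in> edges G" for u v
    using obs[OF that] by (meson card_mono le_trans)
  have "verts G \<noteq> {}" using nK unfolding n_def by auto
  then obtain u where u: "u \<in> verts G" by blast
  then have "nbh G u \<noteq> {}" using deg nK by fastforce
  then obtain v where uv: "{u, v} \<in> edges G" by (auto simp: nbh_def)
  then have v: "v \<in> verts G" using edge_verts[OF simple] by blast
  obtain T where T: "finite T" "card T \<le> K" "nbh G u \<inter> nbh G v \<subseteq> T"
    "\<forall>x\<in>nbh G u - T. \<forall>z\<in>nbh G v - T. \<not> rich G x z"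
    using obs[OF uv] by blast
  define X where "X = nbh G u - T"
  define Y where "Y = nbh G v - T"
  define W where "W = verts G - (X \<union> Y)"
  have fin: "finite X" "finite Y" "finite W"
    by (auto simp: X_def Y_def W_def fin_nbh fin_verts)
  have XY: "X \<inter> Y = {}" "X \<subseteq> verts G" "Y \<subseteq> verts G"
    using T(3) nbh_verts by (auto simp: X_def Y_def)
  have cX: "card (nbh G u) \<le> card X + K" "card (nbh G v) \<le> card Y + K"
    using diff_card_le_card_Diff[OF T(1)] T(2) unfolding X_def Y_def
    by (meson add_le_mono le_diff_conv le_refl le_trans)+
  have cXY: "card X + card Y + card W = n"
  proof -
    have "card (X \<union> Y) = card X + card Y" using fin XY by (simp add: card_Un_disjoint)
    moreover have "card W = n - card (X \<union> Y)" "card (X \<union> Y) \<le> n"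
      unfolding W_def n_def using XY fin fin_verts
      by (auto simp: card_Diff_subset intro!: card_mono)
    ultimately show ?thesis by linarith
  qed
  have sizes: "48 * n \<le> 100 * card X" "48 * n \<le> 100 * card Y" "100 * card W \<le> 4 * n"
      "100 * card X \<le> 52 * n" "100 * card Y \<le> 52 * n"
    using cX cXY deg[OF u] deg[OF v] nK by linarith+
  have ne: "X \<noteq> {}" "Y \<noteq> {}" using sizes nK by auto
  have notrich: "\<not> rich G x x'" if "{x, x'} \<in> edges G" for x x'
    using codeg[OF that] nK unfolding rich_def n_def by linarith
  have indX: "nbh G x \<inter> X = {}" if "x \<in> X" for x
  proof (rule ccontr)
    assume "nbh G x \<inter> X \<noteq> {}"
    then obtain x' where x': "x' \<in> X" "{x, x'} \<in> edges G" by (auto simp: nbh_def)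
    obtain y where y: "y \<in> Y" using ne by blast
    show False
      using rich_of_three[of x x' y] notrich[OF x'(2)] T(4) that x' y XY unfolding X_def Y_def by blast
  qed
  have indY: "nbh G y \<inter> Y = {}" if "y \<in> Y" for y
  proof (rule ccontr)
    assume "nbh G y \<inter> Y \<noteq> {}"
    then obtain y' where y': "y' \<in> Y" "{y, y'} \<in> edges G" by (auto simp: nbh_def)
    obtain x where x: "x \<in> X" using ne by blast
    show False
      using rich_of_three[of x y y'] notrich[OF y'(2)] T(4) that y' x XY unfolding X_def Y_def by blast
  qed
  have degY: "45 * n \<le> 100 * card (nbh G x \<inter> Y)" if "x \<in> verts G" "nbh G x \<inter> X = {}" for x
  proof -
    have "nbh G x \<subseteq> (nbh G x \<inter> Y) \<union> W" using that(2) nbh_verts by (auto simp: W_def)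
    then have "card (nbh G x) \<le> card (nbh G x \<inter> Y) + card W"
      by (meson card_Un_le card_mono fin finite_Int finite_UnI le_trans)
    then show ?thesis using deg[OF that(1)] sizes by linarith
  qed
  have degX: "45 * n \<le> 100 * card (nbh G x \<inter> X)" if "x \<in> verts G" "nbh G x \<inter> Y = {}" for x
  proof -
    have "nbh G x \<subseteq> (nbh G x \<inter> X) \<union> W" using that(2) nbh_verts by (auto simp: W_def)
    then have "card (nbh G x) \<le> card (nbh G x \<inter> X) + card W"
      by (meson card_Un_le card_mono fin finite_Int finite_UnI le_trans)
    then show ?thesis using deg[OF that(1)] sizes by linarith
  qed
  \<comment> \<open>A neighbour \<open>x\<close> in \<open>X\<close> sees at least 45 percent of all
    vertices within \<open>Y\<close>, which has at most 52 percent, and shares at most one percent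
    with \<open>z\<close>; this leaves \<open>z\<close> at most 8 percent in \<open>Y\<close>, and
    likewise in \<open>X\<close>. With the 4 percent of \<open>W\<close> the total is below the
    minimum degree.\<close>
  have one_side: "nbh G z \<inter> X = {} \<or> nbh G z \<inter> Y = {}" if z: "z \<in> verts G" for z
  proof (rule ccontr)
    assume "\<not> ?thesis"
    then obtain x y where x: "x \<in> X" "{z, x} \<in> edges G" and y: "y \<in> Y" "{z, y} \<in> edges G"
      by (auto simp: nbh_def)
    have bound: "card (nbh G z \<inter> S) + card (nbh G w \<inter> S) \<le> card S + K"
      if "{z, w} \<in> edges G" "finite S" for w S
    proof -
      have "card (nbh G z \<inter> S) + card (nbh G w \<inter> S) =
          card ((nbh G z \<inter> S) \<union> (nbh G w \<inter> S)) + card ((nbh G z \<inter> S) \<inter> (nbh G w \<inter> S))"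
        using that(2) by (intro card_Un_Int) auto
      moreover have "card ((nbh G z \<inter> S) \<union> (nbh G w \<inter> S)) \<le> card S"
        using that(2) by (intro card_mono) auto
      moreover have "card ((nbh G z \<inter> S) \<inter> (nbh G w \<inter> S)) \<le> card (nbh G z \<inter> nbh G w)"
        using fin_nbh by (intro card_mono) auto
      ultimately show ?thesis using codeg[OF that(1)] by linarith
    qed
    have "nbh G z \<subseteq> (nbh G z \<inter> X) \<union> (nbh G z \<inter> Y) \<union> W" using nbh_verts by (auto simp: W_def)
    then have "card (nbh G z) \<le> card ((nbh G z \<inter> X) \<union> (nbh G z \<inter> Y) \<union> W)"
      by (intro card_mono) (use fin in auto)
    also have "\<dots> \<le> card ((nbh G z \<inter> X) \<union> (nbh G z \<inter> Y)) + card W" by (rule card_Un_le)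
    also have "\<dots> \<le> card (nbh G z \<inter> X) + card (nbh G z \<inter> Y) + card W"
      by (simp add: card_Un_le)
    finally show False
      using bound[OF x(2) fin(2)] bound[OF y(2) fin(1)] deg[OF z] sizes nK
        degY[OF _ indX[OF x(1)]] degX[OF _ indY[OF y(1)]] x(1) y(1) XY by force
  qed
  \<comment> \<open>By \<open>one_side\<close>, vertices in \<open>P\<close> see much of
    \<open>Y\<close> and all others see much of \<open>X\<close>. Two vertices with the same
    preference share too many neighbours to be adjacent.\<close>
  define P where "P = {z \<in> verts G. nbh G z \<inter> X = {}}"
  have same_side: False if "{z, z'} \<in> edges G" "finite S" "100 * card S \<le> 52 * n"
      "45 * n \<le> 100 * card (nbh G z \<inter> S)" "45 * n \<le> 100 * card (nbh G z' \<inter> S)" for z z' S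
  proof -
    have "card (nbh G z \<inter> S) + card (nbh G z' \<inter> S) =
        card ((nbh G z \<inter> S) \<union> (nbh G z' \<inter> S)) + card ((nbh G z \<inter> S) \<inter> (nbh G z' \<inter> S))"
      using that(2) by (intro card_Un_Int) auto
    moreover have "card ((nbh G z \<inter> S) \<union> (nbh G z' \<inter> S)) \<le> card S"
      using that(2) by (intro card_mono) auto
    moreover have "card ((nbh G z \<inter> S) \<inter> (nbh G z' \<inter> S)) \<le> card (nbh G z \<inter> nbh G z')"
      using fin_nbh by (intro card_mono) auto
    ultimately show False using codeg[OF that(1)] that(3-5) nK by linarith
  qed
  have "bipartition G P (verts G - P)"
    unfolding bipartition_def
  proof (intro conjI ballI)
    show "P \<union> (verts G - P) = verts G" by (auto simp: P_def)
    show "P \<inter> (verts G - P) = {}" by auto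
    fix e assume e: "e \<in> edges G"
    then obtain z z' where z: "e = {z, z'}" "z \<in> verts G" "z' \<in> verts G"
      by (rule edgeE[OF simple])
    have "\<not> (z \<in> P \<and> z' \<in> P)"
      using same_side[of z z' Y] degY[of z] degY[of z'] e z fin sizes by (auto simp: P_def)
    moreover have "\<not> (z \<notin> P \<and> z' \<notin> P)"
      using same_side[of z z' X] degX[of z] degX[of z'] e z fin sizes one_side[OF z(2)] one_side[OF z(3)]
      by (auto simp: P_def)
    ultimately show "\<exists>a\<in>P. \<exists>b\<in>verts G - P. e = {a, b}"
      using z by (metis Diff_iff insert_commute)
  qed
  then show ?thesis by blast
qed

end

section \<open>Deleting vertices of low degree\<close>

lemma verts_induced [simp]: "verts (induced G U) = U"
  by (simp add: induced_def)

lemma edges_induced: "edges (induced G U) = {e \<in> edges G. e \<subseteq> U}"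
  by (simp add: induced_def)

lemma simple_induced: "simple_graph G \<Longrightarrow> U \<subseteq> verts G \<Longrightarrow> simple_graph (induced G U)"
  by (auto simp: simple_graph_def induced_def intro: finite_subset)

lemma induced_induced: "U \<subseteq> W \<Longrightarrow> induced (induced G W) U = induced G U"
  by (auto simp: induced_def)

lemma induced_verts: "simple_graph G \<Longrightarrow> induced G (verts G) = G"
  by (rule prod_eqI) (auto simp: induced_def simple_graph_def)

lemma contains_copy_mono:
  assumes "contains_copy F G" "verts G \<subseteq> verts H" "edges G \<subseteq> edges H"
  shows "contains_copy F H"
  using assms unfolding contains_copy_def by (meson order_trans subsetD)

lemma card_edges_eq_degree_plus:
  assumes "simple_graph G" "v \<in> verts G"
  shows "card (edges G) = card (edges (induced G (verts G - {v}))) + card (nbh G v)"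
proof -
  have "edges G = edges (induced G (verts G - {v})) \<union> (\<lambda>w. {v, w}) ` nbh G v" (is "_ = ?A \<union> ?B")
  proof
    show "edges G \<subseteq> ?A \<union> ?B"
    proof
      fix e assume e: "e \<in> edges G"
      then obtain x y where "e = {x, y}" "x \<in> verts G" "y \<in> verts G" using edgeE assms(1) by metis
      then show "e \<in> ?A \<union> ?B"
        using e by (cases "v = x \<or> v = y") (auto simp: edges_induced nbh_def insert_commute)
    qed
  qed (auto simp: edges_induced nbh_def)
  moreover have "?A \<inter> ?B = {}" by (auto simp: edges_induced)
  moreover have "finite ?A" using finite_edges[OF assms(1)] by (simp add: edges_induced)
  moreover have "finite ?B" using finite_nbh[OF assms(1)] by simp
  moreover have "card ?B = card (nbh G v)"
    by (rule card_image) (auto simp: inj_on_def doubleton_eq_iff)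
  ultimately show ?thesis by (metis card_Un_disjoint)
qed

lemma card_edges_le:
  assumes "simple_graph G"
  shows "card (edges G) \<le> card (verts G) ^ 2"
proof -
  have "edges G \<subseteq> (\<lambda>(x, y). {x, y}) ` (verts G \<times> verts G)"
  proof
    fix e assume "e \<in> edges G"
    then obtain x y where "e = {x, y}" "x \<in> verts G" "y \<in> verts G" using edgeE assms by metis
    then show "e \<in> (\<lambda>(x, y). {x, y}) ` (verts G \<times> verts G)" by force
  qed
  moreover have fin: "finite (verts G \<times> verts G)" using assms by (simp add: simple_graph_def)
  ultimately have "card (edges G) \<le> card (verts G \<times> verts G)" by (meson card_image_le card_mono finite_imageI le_trans)
  then show ?thesis by (simp add: card_cartesian_product power2_eq_square)
qed

text \<open>A vertex deleted from a graph on \<open>r\<close> vertices had degree less than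
  \<open>49 r / 100\<close>; summing over \<open>r\<close> gives the quadratic terms. The process
  stops at a graph of large minimum degree, possibly the empty one.\<close>

lemma ex_dense_subgraph:
  assumes "simple_graph G"
  shows "\<exists>U\<subseteq>verts G. dense_graph (induced G U) \<and>
    200 * card (edges G) + 49 * (card U * (card U + 1)) \<le>
    200 * card (edges (induced G U)) + 49 * (card (verts G) * (card (verts G) + 1))"
  using assms
proof (induction "card (verts G)" arbitrary: G)
  case 0
  then have "verts G = {}" by (simp add: simple_graph_def)
  then have "dense_graph (induced G (verts G))"
    using 0(2) by (simp add: dense_graph_def simple_induced)
  then show ?case
    using 0 by (intro exI[of _ "verts G"]) (auto simp: induced_verts)
next
  case (Suc n)
  show ?case
  proof (cases "dense_graph G")
    case True
    then show ?thesis using Suc by (intro exI[of _ "verts G"]) (auto simp: induced_verts)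
  next
    case False
    then obtain v where v: "v \<in> verts G" "100 * card (nbh G v) < 49 * card (verts G)"
      using Suc.prems unfolding dense_graph_def by (auto simp: not_le)
    define W where "W = verts G - {v}"
    have fin: "finite (verts G)" using Suc.prems by (simp add: simple_graph_def)
    have W: "W \<subseteq> verts G" "card W = n" using v fin Suc.hyps(2) by (auto simp: W_def)
    obtain U where U: "U \<subseteq> W" "dense_graph (induced (induced G W) U)"
      "200 * card (edges (induced G W)) + 49 * (card U * (card U + 1)) \<le>
        200 * card (edges (induced (induced G W) U)) + 49 * (card W * (card W + 1))"
      using Suc.hyps(1)[of "induced G W"] W simple_induced[OF Suc.prems W(1)] by auto
    have "card (edges G) = card (edges (induced G W)) + card (nbh G v)"
      unfolding W_def by (rule card_edges_eq_degree_plus[OF Suc.prems v(1)])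
    moreover have "card (verts G) * (card (verts G) + 1) = n * (n + 1) + 2 * (n + 1)"
      using Suc.hyps(2)[symmetric] by simp
    ultimately have "200 * card (edges G) + 49 * (card U * (card U + 1)) \<le>
        200 * card (edges (induced G U)) + 49 * (card (verts G) * (card (verts G) + 1))"
      using U(3) v(2) W Suc.hyps(2) by (simp add: induced_induced[OF U(1)])
    then show ?thesis
      using U W by (intro exI[of _ U]) (auto simp: induced_induced)
  qed
qed

lemma bipartition_card_edges:
  assumes "simple_graph G" "bipartition G A B"
  shows "card (edges G) + card {(a, b). a \<in> A \<and> b \<in> B \<and> {a, b} \<notin> edges G} = card A * card B"
proof -
  have fin: "finite A" "finite B"
    using assms by (auto simp: bipartition_def simple_graph_def intro: finite_subset)
  let ?P = "{(a, b). a \<in> A \<and> b \<in> B \<and> {a, b} \<in> edges G}"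
  let ?Q = "{(a, b). a \<in> A \<and> b \<in> B \<and> {a, b} \<notin> edges G}"
  have "(\<lambda>(a, b). {a, b}) ` ?P = edges G"
    using assms(2) by (fastforce simp: bipartition_def)
  moreover have "inj_on (\<lambda>(a, b). {a, b}) ?P"
    using assms(2) by (auto simp: inj_on_def bipartition_def doubleton_eq_iff)
  ultimately have "bij_betw (\<lambda>(a, b). {a, b}) ?P (edges G)" unfolding bij_betw_def by blast
  then have "card (edges G) = card ?P" by (rule bij_betw_same_card[symmetric])
  moreover have "card (?P \<union> ?Q) = card ?P + card ?Q"
  proof (rule card_Un_disjoint)
    show "finite ?P" "finite ?Q"
      by (rule finite_subset[of _ "A \<times> B"]; use fin in auto)+
  qed auto
  moreover have "?P \<union> ?Q = A \<times> B" by auto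
  ultimately show ?thesis by (simp add: card_cartesian_product)
qed

lemma bipartition_card_verts:
  assumes "simple_graph G" "bipartition G A B"
  shows "card A + card B = card (verts G)" "finite A" "finite B"
proof -
  show "finite A" "finite B"
    using assms by (auto simp: bipartition_def simple_graph_def intro: finite_subset)
  then show "card A + card B = card (verts G)"
    using assms(2) by (metis bipartition_def card_Un_disjoint)
qed

lemma four_mult_le_square: "4 * (a * b) \<le> (a + b)\<^sup>2" for a b :: real
proof -
  have "0 \<le> (a - b)\<^sup>2" by simp
  then show ?thesis by (simp add: power2_eq_square algebra_simps)
qed

text \<open>Truth values that alternate along \<open>2 * k + 1\<close> vertices agree at the first
  and the last one, yet these are consecutive on the cycle.\<close>

lemma no_alternating_odd_cycle:
  assumes "\<And>j. j < 2 * k + 1 \<Longrightarrow> P (c (Suc j mod (2 * k + 1))) \<longleftrightarrow> \<not> P (c j)"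
  shows False
proof -
  have "P (c j) \<longleftrightarrow> (if even j then P (c 0) else \<not> P (c 0))" if "j < 2 * k + 1" for j
    using that
  proof (induction j)
    case (Suc j)
    then show ?case using assms[of j] by auto
  qed simp
  from this[of "2 * k"] assms[of "2 * k"] show False by simp
qed

lemma bipartite_F_free:
  assumes "bipartition G A B" "s \<ge> 1"
  shows "F_free (F_graph s k) G"
  unfolding F_free_def
proof
  assume "contains_copy (F_graph s k) G"
  then obtain h where h: "\<And>i j. i < s \<Longrightarrow> j < 2*k+1 \<Longrightarrow> {h (glue i j), h (glue i (Suc j mod (2*k+1)))} \<in> edges G"
    by (rule contains_copyE) blast
  show False
  proof (rule no_alternating_odd_cycle[where P = "\<lambda>x. x \<in> A" and c = "\<lambda>j. h (glue 0 j)" and k = k])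
    fix j assume "j < 2 * k + 1"
    then have "{h (glue 0 j), h (glue 0 (Suc j mod (2*k+1)))} \<in> edges G"
      using assms(2) h by simp
    then show "h (glue 0 (Suc j mod (2 * k + 1))) \<in> A \<longleftrightarrow> \<not> h (glue 0 j) \<in> A"
      using assms(1) unfolding bipartition_def by (metis disjoint_iff doubleton_eq_iff)
  qed
qed

text \<open>If the dense core \<open>U\<close> is small, deletion alone accounts for too few edges;
  otherwise \<open>ex_bipartition\<close> applies to it. The last subtracted term is the gain from
  deleting vertices of degree below 49 percent rather than half of the current order; it later
  bounds the number of deleted vertices.\<close>

lemma F_free_structure:
  assumes G: "simple_graph G" "F_free (F_graph s k) G" and k: "k \<ge> 2"
    and n: "card (verts G) = n" "n \<ge> 800 + 30 * (100 * (2 * k * s + 2 * k + 10))"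
  shows "real (card (edges G)) \<le> 99 / 400 * real n ^ 2 \<or>
    (\<exists>U\<subseteq>verts G. \<exists>A B. bipartition (induced G U) A B \<and>
      real (card (edges G)) \<le> real (card (edges (induced G U))) +
        (real n ^ 2 - real (card U) ^ 2) / 4 - real n * (real n - real (card U)) / 400)"
proof -
  define n1 where "n1 = 100 * (2 * k * s + 2 * k + 10)"
  have n01: "n \<ge> 800 + 30 * n1" using n(2) by (simp add: n1_def)
  obtain U where U: "U \<subseteq> verts G" "dense_graph (induced G U)"
    "200 * card (edges G) + 49 * (card U * (card U + 1)) \<le>
      200 * card (edges (induced G U)) + 49 * (n * (n + 1))"
    using ex_dense_subgraph[OF G(1)] n(1) by auto
  define u where "u = card U"
  define x where "x = real n"
  define y where "y = real u"
  have fin: "finite (verts G)" using G(1) by (simp add: simple_graph_def)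
  have "u \<le> n" unfolding u_def n(1)[symmetric] by (rule card_mono[OF fin U(1)])
  then have yx: "0 \<le> y" "y \<le> x" "x \<ge> 800" using n(2) by (auto simp: x_def y_def)
  have "real (200 * card (edges G) + 49 * (u * (u + 1))) \<le>
      real (200 * card (edges (induced G U)) + 49 * (n * (n + 1)))"
    using U(3) unfolding u_def by (simp only: of_nat_le_iff)
  then have main: "200 * real (card (edges G)) + 49 * (y * (y + 1)) \<le>
      200 * real (card (edges (induced G U))) + 49 * (x * (x + 1))"
    by (simp add: x_def y_def algebra_simps)
  show ?thesis
  proof (cases "u < n1")
    case True
    have "card (edges (induced G U)) \<le> u ^ 2"
      using card_edges_le[OF simple_induced[OF G(1) U(1)]] by (simp add: u_def)
    also have "\<dots> \<le> n1 ^ 2" using True by (simp add: power_mono)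
    finally have "real (card (edges (induced G U))) \<le> real n1 ^ 2"
      by (metis of_nat_le_iff of_nat_power)
    \<comment> \<open>The at most \<open>n1 ^ 2\<close> remaining edges and the linear term are
      absorbed by the gap between \<open>98 / 400\<close> and \<open>99 / 400\<close>.\<close>
    moreover have "(30 * real n1) ^ 2 \<le> x ^ 2"
      by (rule power_mono) (use n01 in \<open>auto simp: x_def\<close>)
    moreover have "800 * x \<le> x ^ 2" using yx by (simp add: power2_eq_square mult_right_mono)
    moreover have "0 \<le> y * (y + 1)" using yx by simp
    moreover have "(30 * real n1) ^ 2 = 900 * real n1 ^ 2" by (simp add: power_mult_distrib)
    moreover have "x * (x + 1) = x ^ 2 + x" by (simp add: power2_eq_square algebra_simps)
    ultimately have "real (card (edges G)) \<le> 99 / 400 * x ^ 2" using main by linarith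
    then show ?thesis by (simp add: x_def)
  next
    case False
    have "\<not> contains_copy (F_graph s k) (induced G U)"
      using G(2) contains_copy_mono[of "F_graph s k" "induced G U" G] U(1)
      by (auto simp: F_free_def edges_induced)
    then obtain A B where AB: "bipartition (induced G U) A B"
      using dense_graph.ex_bipartition[OF U(2) _ k, where s = s] False unfolding n1_def u_def by auto
    \<comment> \<open>Up to the factor \<open>400\<close> this product is the allowance
      \<open>(x ^ 2 - y ^ 2) / 4 - x * (x - y) / 400\<close> minus the deletion cost
      \<open>49 * (x * (x + 1) - y * (y + 1)) / 200\<close>.\<close>
    have "0 \<le> (x - y) * (x + 2 * y - 98)" using yx by (intro mult_nonneg_nonneg) auto
    then have "real (card (edges G)) \<le> real (card (edges (induced G U))) +
        (x ^ 2 - y ^ 2) / 4 - x * (x - y) / 400"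
      using main by (simp add: power2_eq_square field_simps)
    then show ?thesis using AB U(1) unfolding x_def y_def u_def by blast
  qed
qed

corollary F_free_card_edges_le:
  assumes G: "simple_graph G" "F_free (F_graph s k) G" and k: "k \<ge> 2"
    and n: "card (verts G) = n" "n \<ge> 800 + 30 * (100 * (2 * k * s + 2 * k + 10))"
  shows "real (card (edges G)) \<le> real n ^ 2 / 4"
  using F_free_structure[OF assms]
proof (elim disjE exE conjE)
  assume "real (card (edges G)) \<le> 99 / 400 * (real n)\<^sup>2"
  then show ?thesis by (simp add: field_simps)
next
  fix U A B
  assume U: "U \<subseteq> verts G" and AB: "bipartition (induced G U) A B"
    and le: "real (card (edges G)) \<le> real (card (edges (induced G U))) +
        (real n ^ 2 - real (card U) ^ 2) / 4 - real n * (real n - real (card U)) / 400"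
  have simp: "simple_graph (induced G U)" using simple_induced[OF G(1) U] .
  have "card U \<le> n" unfolding n(1)[symmetric]
    using U G(1) by (auto simp: simple_graph_def intro: card_mono)
  then have "0 \<le> real n * (real n - real (card U))" by simp
  moreover have "real (card (edges (induced G U))) \<le> real (card A * card B)"
    using bipartition_card_edges[OF simp AB] by (intro of_nat_mono) linarith
  then have "real (card (edges (induced G U))) \<le> real (card A) * real (card B)" by simp
  moreover have "real (card A) + real (card B) = real (card U)"
    using bipartition_card_verts(1)[OF simp AB] by (simp flip: of_nat_add)
  ultimately show ?thesis
    using le four_mult_le_square[of "real (card A)" "real (card B)"]
    by (simp add: field_simps)
qed

section \<open>Bounds for the Turan number of \<open>F\<close>\<close>

definition complete_bipartite_graph :: "'a set \<Rightarrow> 'a set \<Rightarrow> 'a sgraph" where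
  "complete_bipartite_graph A B = (A \<union> B, {{a, b} | a b. a \<in> A \<and> b \<in> B})"

lemma finite_edge_counts: "finite {card (edges G) | G. graph_on n G \<and> F_free F G}"
proof (rule finite_subset)
  show "{card (edges G) | G. graph_on n G \<and> F_free F G} \<subseteq> {..n ^ 2}"
    using card_edges_le by (auto simp: graph_on_def)
qed simp

lemma ex_number_ge:
  assumes "graph_on n G" "F_free F G"
  shows "card (edges G) \<le> ex_number n F"
  unfolding ex_number_def by (rule Max_ge[OF finite_edge_counts]) (use assms in blast)

lemma ex_number_attained:
  assumes "graph_on n G" "F_free F G"
  obtains H where "graph_on n H" "F_free F H" "ex_number n F = card (edges H)"
proof -
  have "ex_number n F \<in> {card (edges G) | G. graph_on n G \<and> F_free F G}"
    unfolding ex_number_def by (rule Max_in[OF finite_edge_counts]) (use assms in blast)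
  then show thesis using that by blast
qed

lemma balanced_product_ge:
  fixes r :: nat
  shows "(real r ^ 2 - 1) / 4 \<le> real (r div 2 * (r - r div 2))"
proof (cases "even r")
  case True
  then obtain c where "r = 2 * c" by blast
  then show ?thesis by (simp add: power2_eq_square)
next
  case False
  then obtain c where "r = 2 * c + 1" using oddE by blast
  then show ?thesis by (simp add: power2_eq_square algebra_simps)
qed

lemma balanced_complete_bipartite:
  assumes "s \<ge> 1"
  shows "\<exists>G. graph_on n G \<and> F_free (F_graph s k) G \<and> real n ^ 2 / 4 - 1 / 4 \<le> real (card (edges G))"
proof -
  define A where "A = {..<n div 2}"
  define B where "B = {n div 2..<n}"
  define G where "G = complete_bipartite_graph A B"
  have AB: "A \<inter> B = {}" "A \<union> B = {..<n}" by (auto simp: A_def B_def)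
  have bip: "bipartition G A B"
    using AB(1) by (auto simp: bipartition_def G_def complete_bipartite_graph_def)
  have "card {a, b} = 2" if "a \<in> A" "b \<in> B" for a b
    using that by (auto simp: A_def B_def card_insert_if)
  then have simp: "simple_graph G"
    by (auto simp: simple_graph_def G_def complete_bipartite_graph_def A_def B_def)
  have no_pairs: "{(a, b). a \<in> A \<and> b \<in> B \<and> {a, b} \<notin> edges G} = {}"
    by (auto simp: G_def complete_bipartite_graph_def)
  have "card (edges G) = (n div 2) * (n - n div 2)"
    using bipartition_card_edges[OF simp bip] unfolding no_pairs by (simp add: A_def B_def)
  moreover have "real n ^ 2 / 4 - 1 / 4 \<le> real ((n div 2) * (n - n div 2))"
    using balanced_product_ge[of n] by (simp add: diff_divide_distrib)
  moreover have "graph_on n G"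
    using simp AB by (simp add: graph_on_def G_def complete_bipartite_graph_def)
  ultimately show ?thesis using bipartite_F_free[OF bip assms] by metis
qed

lemma ex_number_lower:
  assumes "s \<ge> 1"
  shows "real n ^ 2 / 4 - 1 / 4 \<le> real (ex_number n (F_graph s k))"
  using balanced_complete_bipartite[OF assms, of n k] ex_number_ge by (metis of_nat_le_iff order_trans)

lemma ex_number_upper:
  assumes "s \<ge> 1" "k \<ge> 2" "n \<ge> 800 + 30 * (100 * (2 * k * s + 2 * k + 10))"
  shows "real (ex_number n (F_graph s k)) \<le> real n ^ 2 / 4"
proof -
  obtain G where "graph_on n G" "F_free (F_graph s k) G"
    using balanced_complete_bipartite[OF assms(1)] by blast
  then obtain H where "graph_on n H" "F_free (F_graph s k) H" "ex_number n (F_graph s k) = card (edges H)"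
    by (rule ex_number_attained)
  then show ?thesis using F_free_card_edges_le[of H s k n] assms by (simp add: graph_on_def)
qed

section \<open>Splicing copies of \<open>F\<close>\<close>

text \<open>Cauchy-Schwarz over the fibres of \<open>f\<close>.\<close>

lemma card_square_le_card_pairs:
  assumes "finite I" "finite S" "f ` I \<subseteq> S"
  shows "card I ^ 2 \<le> card S * card {(i, j). i \<in> I \<and> j \<in> I \<and> f i = f j}"
proof -
  let ?c = "\<lambda>y. card {i \<in> I. f i = y}"
  have pairs: "{(i, j). i \<in> I \<and> j \<in> I \<and> f i = f j} = (\<Union>y\<in>S. {i \<in> I. f i = y} \<times> {i \<in> I. f i = y})"
    using assms(3) by auto
  have "card (\<Union>y\<in>S. {i \<in> I. f i = y} \<times> {i \<in> I. f i = y}) =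
      (\<Sum>y\<in>S. card ({i \<in> I. f i = y} \<times> {i \<in> I. f i = y}))"
    by (rule card_UN_disjoint) (use assms in auto)
  then have "card {(i, j). i \<in> I \<and> j \<in> I \<and> f i = f j} = (\<Sum>y\<in>S. ?c y * ?c y)"
    unfolding pairs by (simp add: card_cartesian_product)
  moreover have "card I = (\<Sum>y\<in>S. ?c y)"
  proof -
    have "I = (\<Union>y\<in>S. {i \<in> I. f i = y})" using assms(3) by auto
    then have "card I = card (\<Union>y\<in>S. {i \<in> I. f i = y})" by simp
    also have "\<dots> = (\<Sum>y\<in>S. ?c y)" by (rule card_UN_disjoint) (use assms in auto)
    finally show ?thesis .
  qed
  moreover have "real ((\<Sum>y\<in>S. ?c y) ^ 2) \<le> real (card S * (\<Sum>y\<in>S. ?c y * ?c y))"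
    using sum_squared_le_sum_of_squares[where I = S and f = "\<lambda>y. real (?c y)"]
    by (simp add: power2_eq_square mult.commute)
  ultimately show ?thesis by (simp only: of_nat_le_iff)
qed

text \<open>A uniformly random colouring \<open>c\<close> satisfies \<open>c \<circ> h i = id\<close> on \<open>W\<close> with probability \<open>|W|\<^bsup>-|W|\<^esup>\<close>.\<close>

lemma ex_good_colouring:
  assumes "finite V" "finite I" "finite W" "W \<noteq> {}"
    and inj: "\<And>i. i \<in> I \<Longrightarrow> inj_on (h i) W" and sub: "\<And>i. i \<in> I \<Longrightarrow> h i ` W \<subseteq> V"
  shows "\<exists>c. card I \<le> card W ^ card W * card {i \<in> I. \<forall>x\<in>W. c (h i x) = x}"
proof (rule ccontr)
  assume "\<not> ?thesis"
  then have less: "card W ^ card W * card {i \<in> I. \<forall>x\<in>W. c (h i x) = x} < card I" for c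
    by (simp add: not_le)
  define w where "w = card W"
  define C where "C = (V \<rightarrow>\<^sub>E W)"
  have w: "w > 0" using assms by (simp add: w_def card_gt_0_iff)
  have cardC: "card C = w ^ card V" using assms(1) by (simp add: C_def w_def card_PiE)
  have finC: "finite C" using assms by (simp add: C_def finite_PiE)
  then have neC: "C \<noteq> {}" using cardC w by (metis card.empty power_not_zero less_irrefl)
  have good: "w ^ card V \<le> w ^ w * card {c \<in> C. \<forall>x\<in>W. c (h i x) = x}" if i: "i \<in> I" for i
  proof -
    \<comment> \<open>The \<open>w\<close> vertices in the image of \<open>h i\<close> have forced
      colours and the others are free; hence at least one colouring in \<open>w ^ w\<close> is good
      for \<open>i\<close>.\<close>
    let ?T = "\<lambda>v. if v \<in> h i ` W then {inv_into W (h i) v} else W"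
    have inv: "inv_into W (h i) (h i x) \<in> W" if "x \<in> W" for x
      using that inj[OF i] by (simp add: inv_into_f_f)
    have "PiE V ?T \<subseteq> {c \<in> C. \<forall>x\<in>W. c (h i x) = x}"
    proof (intro subsetI CollectI conjI ballI)
      fix c assume c: "c \<in> PiE V ?T"
      have "?T v \<subseteq> W" for v using inv by auto
      with c show "c \<in> C" unfolding C_def by (meson PiE_mono subsetD)
      fix x assume x: "x \<in> W"
      then have "h i x \<in> V" using sub[OF i] by auto
      then have "c (h i x) \<in> ?T (h i x)" using c by (rule PiE_mem[rotated])
      then show "c (h i x) = x" using x inj[OF i] by (simp add: inv_into_f_f)
    qed
    moreover have "finite {c \<in> C. \<forall>x\<in>W. c (h i x) = x}" using finC by simp
    ultimately have "card (PiE V ?T) \<le> card {c \<in> C. \<forall>x\<in>W. c (h i x) = x}" by (rule card_mono[rotated])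
    moreover have "card (PiE V ?T) = w ^ card (V - h i ` W)"
    proof -
      have "card (PiE V ?T) = (\<Prod>v\<in>V. card (?T v))" using assms(1) by (rule card_PiE)
      also have "\<dots> = (\<Prod>v\<in>V. if v \<in> h i ` W then 1 else w)"
        by (rule prod.cong) (auto simp: w_def)
      also have "\<dots> = (\<Prod>v\<in>V - h i ` W. w)"
        by (rule prod.mono_neutral_cong_right) (use assms(1) in auto)
      finally show ?thesis by simp
    qed
    moreover have "card V = w + card (V - h i ` W)"
      using card_image[OF inj[OF i]] sub[OF i] assms(1) finite_subset[OF sub[OF i] assms(1)]
        card_mono[OF assms(1) sub[OF i]]
      by (simp add: card_Diff_subset w_def)
    ultimately show ?thesis by (simp add: power_add)
  qed
  have "card I * w ^ card V = (\<Sum>i\<in>I. w ^ card V)" by simp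
  also have "\<dots> \<le> (\<Sum>i\<in>I. w ^ w * card {c \<in> C. \<forall>x\<in>W. c (h i x) = x})"
    by (intro sum_mono good)
  also have "\<dots> = w ^ w * (\<Sum>i\<in>I. card {c \<in> C. \<forall>x\<in>W. c (h i x) = x})"
    by (simp add: sum_distrib_left)
  also have "(\<Sum>i\<in>I. card {c \<in> C. \<forall>x\<in>W. c (h i x) = x}) =
      (\<Sum>c\<in>C. card {i \<in> I. \<forall>x\<in>W. c (h i x) = x})"
    using sum.swap_restrict[OF assms(2) finC, of "\<lambda>_ _. 1::nat" "\<lambda>i c. \<forall>x\<in>W. c (h i x) = x"]
    by simp
  also have "w ^ w * \<dots> = (\<Sum>c\<in>C. w ^ w * card {i \<in> I. \<forall>x\<in>W. c (h i x) = x})"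
    by (simp add: sum_distrib_left)
  also have "\<dots> < (\<Sum>c\<in>C. card I)"
    by (rule sum_strict_mono) (use finC neC less in \<open>auto simp: w_def\<close>)
  also have "\<dots> = card I * w ^ card V" using cardC by simp
  finally show False by simp
qed

section \<open>Cutting and splicing two copies\<close>

text \<open>\<open>X\<close> is one side of a cut of \<open>F\<close> without the edge
  \<open>(i0, j0)\<close>, crossed only at one chosen vertex per cycle. If the edge is the shared
  one, every cycle turns into a path that its chosen vertex cuts. If it is private to a cycle, it
  encloses, together with the chosen vertex of that cycle, an arc whose interior has no shared
  vertex.\<close>

lemma ex_separator:
  assumes i0: "i0 < s" and j0: "j0 < 2 * k + 1"
    and \<sigma>: "\<And>i. i < s \<Longrightarrow> \<sigma> i < 2 * k + 1 \<and> glue i (\<sigma> i) \<noteq> glue i0 j0 \<and>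
      glue i (\<sigma> i) \<noteq> glue i0 (Suc j0 mod (2 * k + 1))"
  shows "\<exists>X. (glue i0 j0 \<in> X \<longleftrightarrow> glue i0 (Suc j0 mod (2 * k + 1)) \<notin> X) \<and>
    (\<forall>i<s. \<forall>j<2*k+1. \<not> (j = j0 \<and> (j0 = 0 \<or> i = i0)) \<longrightarrow>
      j = \<sigma> i \<or> Suc j mod (2*k+1) = \<sigma> i \<or> (glue i j \<in> X \<longleftrightarrow> glue i (Suc j mod (2*k+1)) \<in> X))"
proof -
  have k: "k \<ge> 1"
  proof (rule ccontr)
    assume "\<not> k \<ge> 1"
    then have "k = 0" "j0 = 0" using j0 by auto
    then show False using \<sigma>[OF i0] by auto
  qed
  have sm: "Suc j mod Suc (2 * k) = (if j = 2 * k then 0 else Suc j)" if "j < Suc (2 * k)" for j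
    using that by auto
  let ?t = "\<sigma> i0"
  have t: "?t < 2*k+1" "?t \<noteq> j0" "?t \<noteq> Suc j0 mod (2*k+1)" using \<sigma>[OF i0] by (auto)
  \<comment> \<open>In the first case \<open>X\<close> takes from each cycle the part behind its
    chosen vertex, together with position \<open>0\<close>; in the others it is the arc of cycle
    \<open>i0\<close> between the edge and \<open>?t\<close> that avoids positions \<open>0\<close>
    and \<open>1\<close>. In the last case the arc runs up to \<open>2 * k\<close> and is followed
    by \<open>?t = 0\<close>.\<close>
  consider "j0 = 0" | "j0 \<ge> 1" "?t > j0" | "j0 \<ge> 1" "?t < j0" "?t \<ge> 1" | "j0 \<ge> 1" "?t = 0"
    using t(2) by linarith
  then show ?thesis
  proof cases
    case 1
    have "\<sigma> i \<ge> 2" if "i < s" for i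
    proof -
      have "glue i (\<sigma> i) \<noteq> glue i0 0" "glue i (\<sigma> i) \<noteq> glue i0 1" using \<sigma>[OF that] 1 k by auto
      then show ?thesis by (auto simp: glue_eq_iff)
    qed
    note \<sigma>2 = this
    let ?X = "{p. snd p = 0 \<or> \<sigma> (fst p) < snd p}"
    have "j = \<sigma> i \<or> Suc j mod (2*k+1) = \<sigma> i \<or> (glue i j \<in> ?X \<longleftrightarrow> glue i (Suc j mod (2*k+1)) \<in> ?X)"
      if ij: "i < s" "j < 2*k+1" "j \<noteq> 0" for i j
    proof (cases "j = 1")
      case True
      have "0 < s" using ij by simp
      then show ?thesis using True \<sigma>2[OF ij(1)] \<sigma>2[of 0] k sm[of j] by (auto simp: glue_def)
    next
      case False
      then show ?thesis using \<sigma>2[OF ij(1)] conjunct1[OF \<sigma>[OF ij(1)]] k ij sm[of j] by (auto simp: glue_def)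
    qed
    moreover have "0 < s" using i0 by simp
    then have "glue i0 j0 \<in> ?X \<longleftrightarrow> glue i0 (Suc j0 mod (2 * k + 1)) \<notin> ?X"
      using 1 k \<sigma>2[of 0] by (simp add: glue_def)
    ultimately show ?thesis using 1 by (intro exI[of _ ?X]) blast
  next
    case 2
    then show ?thesis
      using k j0 t by (intro exI[of _ "{(i0, r) | r. j0 < r \<and> r < ?t}"])
        (auto simp: glue_def sm)
  next
    case 3
    then show ?thesis
      using k j0 t by (intro exI[of _ "{(i0, r) | r. ?t < r \<and> r \<le> j0}"])
        (auto simp: glue_def sm)
  next
    case 4
    then show ?thesis
      using k j0 t by (intro exI[of _ "{(i0, r) | r. j0 < r}"])
        (auto simp: glue_def sm split: if_splits)
  qed
qed

lemma cycle_edge_unique: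
  assumes "k \<ge> 1" "j < 2*k+1" "j0 < 2*k+1"
    and eq: "{glue i j, glue i (Suc j mod (2*k+1))} = {glue i0 j0, glue i0 (Suc j0 mod (2*k+1))}"
  shows "j = j0 \<and> (j0 = 0 \<or> i = i0)"
proof -
  have sm: "Suc j mod (2*k+1) = (if j = 2 * k then 0 else Suc j)" if "j < 2*k+1" for j
    using that by auto
  show ?thesis
    using eq assms(1-3) unfolding doubleton_eq_iff glue_eq_iff sm[OF assms(2)] sm[OF assms(3)]
    by (auto split: if_splits)
qed

text \<open>The two copies, each without the edge \<open>(i0, j0)\<close>, are used on the two sides
  of a separator; an edge at a separating vertex can be read in either copy since both agree there.
  The common left inverse \<open>c\<close> makes the spliced map injective.\<close>

lemma contains_copy_mix:
  fixes h h' :: "nat \<times> nat \<Rightarrow> 'a"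
  assumes i0: "i0 < s" and j0: "j0 < 2 * k + 1"
    and \<sigma>: "\<And>i. i < s \<Longrightarrow> \<sigma> i < 2 * k + 1 \<and> glue i (\<sigma> i) \<noteq> glue i0 j0 \<and>
      glue i (\<sigma> i) \<noteq> glue i0 (Suc j0 mod (2 * k + 1))"
    and agree: "\<And>i. i < s \<Longrightarrow> h (glue i (\<sigma> i)) = h' (glue i (\<sigma> i))"
    and col: "\<And>x. x \<in> verts (F_graph s k) \<Longrightarrow> c (h x) = x \<and> c (h' x) = x"
    and verts: "\<And>x. x \<in> verts (F_graph s k) \<Longrightarrow> h x \<in> verts G \<and> h' x \<in> verts G"
    and edges: "\<And>i j. i < s \<Longrightarrow> j < 2*k+1 \<Longrightarrow> \<not> (j = j0 \<and> (j0 = 0 \<or> i = i0)) \<Longrightarrow>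
      {h (glue i j), h (glue i (Suc j mod (2*k+1)))} \<in> edges G \<and>
      {h' (glue i j), h' (glue i (Suc j mod (2*k+1)))} \<in> edges G"
    and cross: "{h (glue i0 j0), h' (glue i0 (Suc j0 mod (2*k+1)))} \<in> edges G"
  shows "contains_copy (F_graph s k) G"
proof -
  obtain X where X: "glue i0 j0 \<in> X \<longleftrightarrow> glue i0 (Suc j0 mod (2 * k + 1)) \<notin> X"
    "\<And>i j. i < s \<Longrightarrow> j < 2*k+1 \<Longrightarrow> \<not> (j = j0 \<and> (j0 = 0 \<or> i = i0)) \<Longrightarrow>
      j = \<sigma> i \<or> Suc j mod (2*k+1) = \<sigma> i \<or> (glue i j \<in> X \<longleftrightarrow> glue i (Suc j mod (2*k+1)) \<in> X)"
    using ex_separator[of i0 s j0 k \<sigma>, OF i0 j0 \<sigma>] by blast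
  define g where "g x = (if x \<in> X \<longleftrightarrow> glue i0 j0 \<in> X then h x else h' x)" for x
  have vert: "glue i j \<in> verts (F_graph s k)" if "i < s" "j < 2*k+1" for i j
    unfolding verts_F_graph using that by blast
  show ?thesis
  proof (rule contains_copyI[where h = g])
    fix i j assume ij: "i < s" "j < 2*k+1"
    show "g (glue i j) \<in> verts G" using verts[OF vert[OF ij]] by (simp add: g_def)
    show "{g (glue i j), g (glue i (Suc j mod (2*k+1)))} \<in> edges G"
    proof (cases "j = j0 \<and> (j0 = 0 \<or> i = i0)")
      case True
      then have "glue i j = glue i0 j0" "glue i (Suc j mod (2*k+1)) = glue i0 (Suc j0 mod (2*k+1))"
        by (cases "k = 0"; auto simp: glue_def)+
      then show ?thesis using cross X(1) by (simp add: g_def)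
    next
      case False
      from X(2)[OF ij False] show ?thesis
      proof (elim disjE)
        assume "j = \<sigma> i"
        then show ?thesis using edges[OF ij False] agree[OF ij(1)] by (simp add: g_def)
      next
        assume "Suc j mod (2*k+1) = \<sigma> i"
        then show ?thesis using edges[OF ij False] agree[OF ij(1)] by (simp add: g_def)
      next
        assume "glue i j \<in> X \<longleftrightarrow> glue i (Suc j mod (2*k+1)) \<in> X"
        then show ?thesis using edges[OF ij False] by (simp add: g_def)
      qed
    qed
  next
    fix i j i' j' assume ij: "i < s" "j < 2*k+1" "i' < s" "j' < 2*k+1"
      and eq: "g (glue i j) = g (glue i' j')"
    have "c (g x) = x" if "x \<in> verts (F_graph s k)" for x
      using col[OF that] by (simp add: g_def)
    then show "glue i j = glue i' j'"
      using vert[OF ij(1,2)] vert[OF ij(3,4)] eq by metis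
  qed
qed

section \<open>Copies created by missing edges and their signatures\<close>

text \<open>Since \<open>G\<close> is \<open>F\<close>-free, the copy created by adding
  \<open>ab\<close> uses \<open>ab\<close>, as the image of just one edge of \<open>F\<close>;
  \<open>d\<close> records its direction. Each cycle is odd while \<open>U\<close> with
  \<open>ab\<close> added is bipartite, so the cycle leaves \<open>U\<close> at some position
  \<open>\<sigma> i\<close>.\<close>

lemma nonedge_signature:
  assumes G: "simple_graph G" "maximal_F_free (F_graph s k) G" and k: "k \<ge> 1"
    and U: "U \<subseteq> verts G" "bipartition (induced G U) A B"
    and ab: "a \<in> A" "b \<in> B" "{a, b} \<notin> edges G"
  shows "\<exists>h i0 j0 d \<sigma>. inj_on h (verts (F_graph s k)) \<and> h ` verts (F_graph s k) \<subseteq> verts G \<and>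
    i0 < s \<and> j0 < 2 * k + 1 \<and>
    h (glue i0 j0) = (if d then a else b) \<and> h (glue i0 (Suc j0 mod (2*k+1))) = (if d then b else a) \<and>
    (\<forall>i<s. \<sigma> i < 2 * k + 1 \<and> h (glue i (\<sigma> i)) \<in> verts G - U) \<and>
    (\<forall>i<s. \<forall>j<2*k+1. \<not> (j = j0 \<and> (j0 = 0 \<or> i = i0)) \<longrightarrow>
      {h (glue i j), h (glue i (Suc j mod (2*k+1)))} \<in> edges G)"
proof -
  let ?N = "2 * k + 1"
  let ?W = "verts (F_graph s k)"
  have AB: "A \<inter> B = {}" "A \<union> B = U" using U(2) by (auto simp: bipartition_def)
  then have ab': "a \<in> verts G" "b \<in> verts G" "a \<noteq> b" using ab U(1) by auto
  have "contains_copy (F_graph s k) (add_edge {a, b} G)"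
    using G(2) ab' ab(3) by (simp add: maximal_F_free_def)
  then obtain h where h: "inj_on h ?W" "h ` ?W \<subseteq> verts G"
    and hE: "\<forall>e\<in>edges (F_graph s k). h ` e \<in> insert {a, b} (edges G)"
    by (auto simp: contains_copy_def add_edge_def)
  have vert: "glue i j \<in> ?W" if "i < s" "j < ?N" for i j
    unfolding verts_F_graph using that by blast
  have edge: "{h (glue i j), h (glue i (Suc j mod ?N))} \<in> insert {a, b} (edges G)" if "i < s" "j < ?N" for i j
  proof -
    have "{glue i j, glue i (Suc j mod ?N)} \<in> edges (F_graph s k)"
      unfolding edges_F_graph using that by blast
    from bspec[OF hE this] show ?thesis by simp
  qed
  have "\<exists>i j. i < s \<and> j < ?N \<and> {h (glue i j), h (glue i (Suc j mod ?N))} = {a, b}"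
  proof (rule ccontr)
    assume no: "\<not> ?thesis"
    have "contains_copy (F_graph s k) G"
    proof (rule contains_copyI[where h = h])
      fix i j assume "i < s" "j < ?N"
      then show "h (glue i j) \<in> verts G" "{h (glue i j), h (glue i (Suc j mod ?N))} \<in> edges G"
        using vert[of i j] h(2) edge[of i j] no by blast+
    next
      fix i j i' j' assume "i < s" "j < ?N" "i' < s" "j' < ?N" "h (glue i j) = h (glue i' j')"
      then show "glue i j = glue i' j'" using h(1) vert by (meson inj_onD)
    qed
    then show False using G(2) by (simp add: maximal_F_free_def F_free_def)
  qed
  then obtain i0 j0 where e: "i0 < s" "j0 < ?N" "{h (glue i0 j0), h (glue i0 (Suc j0 mod ?N))} = {a, b}"
    by blast
  define d where "d \<longleftrightarrow> h (glue i0 j0) = a"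
  have d: "h (glue i0 j0) = (if d then a else b)" "h (glue i0 (Suc j0 mod ?N)) = (if d then b else a)"
    using e(3) ab'(3) by (auto simp: d_def doubleton_eq_iff)
  have other: "{h (glue i j), h (glue i (Suc j mod ?N))} \<in> edges G"
    if ij: "i < s" "j < ?N" "\<not> (j = j0 \<and> (j0 = 0 \<or> i = i0))" for i j
  proof (rule ccontr)
    assume "{h (glue i j), h (glue i (Suc j mod ?N))} \<notin> edges G"
    then have "h ` {glue i j, glue i (Suc j mod ?N)} = h ` {glue i0 j0, glue i0 (Suc j0 mod ?N)}"
      using edge[OF ij(1,2)] e(3) by simp
    then have "{glue i j, glue i (Suc j mod ?N)} = {glue i0 j0, glue i0 (Suc j0 mod ?N)}"
      by (rule inj_on_image_eq_iff[OF h(1), THEN iffD1, rotated 2]) (use vert ij e in auto)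
    then show False using cycle_edge_unique[OF k] ij e by blast
  qed
  have "\<exists>t. t < ?N \<and> h (glue i t) \<in> verts G - U" if i: "i < s" for i
  proof (rule ccontr)
    assume "\<not> ?thesis"
    then have inU: "h (glue i t) \<in> U" if "t < ?N" for t
      using that vert[OF i that] h(2) by blast
    show False
    proof (rule no_alternating_odd_cycle[where P = "\<lambda>x. x \<in> A" and c = "\<lambda>j. h (glue i j)" and k = k])
      fix j assume j: "j < ?N"
      have "\<exists>a\<in>A. \<exists>b\<in>B. {h (glue i j), h (glue i (Suc j mod ?N))} = {a, b}"
      proof (cases "{h (glue i j), h (glue i (Suc j mod ?N))} = {a, b}")
        case True
        then show ?thesis using ab by blast
      next
        case False
        then have "{h (glue i j), h (glue i (Suc j mod ?N))} \<in> edges (induced G U)"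
          using edge[OF i j] inU[OF j] inU[of "Suc j mod ?N"] by (simp add: edges_induced)
        then show ?thesis using U(2) by (simp add: bipartition_def)
      qed
      then show "h (glue i (Suc j mod ?N)) \<in> A \<longleftrightarrow> \<not> h (glue i j) \<in> A"
        using AB(1) by (auto simp: doubleton_eq_iff)
    qed
  qed
  then obtain \<sigma> where "\<forall>i<s. \<sigma> i < ?N \<and> h (glue i (\<sigma> i)) \<in> verts G - U" by metis
  then show ?thesis using h e(1,2) d other by blast
qed

text \<open>Counts the discrete data \<open>(i0, j0, d, \<sigma>)\<close>; the images of the chosen
  positions contribute \<open>card (verts G - U) ^ s\<close> on top.\<close>

definition signature_count :: "nat \<Rightarrow> nat \<Rightarrow> nat" where
  "signature_count s k = s * ((2 * k + 1) * (2 * (2 * k + 1) ^ s))"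

definition copy_size :: "nat \<Rightarrow> nat \<Rightarrow> nat" where
  "copy_size s k = card (verts (F_graph s k))"

text \<open>The signature of a nonadjacent pair \<open>(a, b)\<close> records which oriented edge of \<open>F\<close> is mapped to \<open>ab\<close>, and
  for every cycle a position mapped outside \<open>U\<close> together with its image. If \<open>(a, b)\<close> and \<open>(a', b')\<close> have
  the same signature, then \<open>(a, b')\<close> is nonadjacent too: otherwise the two copies could be spliced along \<open>ab'\<close>.\<close>

lemma nonedge_matching_bound:
  assumes G: "simple_graph G" "maximal_F_free (F_graph s k) G" and k: "k \<ge> 1" and s: "s \<ge> 1"
    and U: "U \<subseteq> verts G" "bipartition (induced G U) A B"
    and M: "M \<subseteq> {(a, b). a \<in> A \<and> b \<in> B \<and> {a, b} \<notin> edges G}" "inj_on fst M" "inj_on snd M"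
  shows "card M ^ 2 \<le> (copy_size s k ^ copy_size s k) ^ 2 * (signature_count s k * card (verts G - U) ^ s) *
    card {(a, b). a \<in> A \<and> b \<in> B \<and> {a, b} \<notin> edges G}"
proof -
  let ?N = "2 * k + 1"
  let ?W = "verts (F_graph s k)"
  let ?NE = "{(a, b). a \<in> A \<and> b \<in> B \<and> {a, b} \<notin> edges G}"
  let ?w = "copy_size s k"
  define L where "L = verts G - U"
  have fin: "finite (verts G)" using G(1) by (simp add: simple_graph_def)
  have finAB: "finite A" "finite B"
    using bipartition_card_verts(2,3)[OF simple_induced[OF G(1) U(1)] U(2)] by auto
  have finNE: "finite ?NE" by (rule finite_subset[of _ "A \<times> B"]) (use finAB in auto)
  have finM: "finite M" using M(1) finNE by (rule finite_subset)
  have AB: "A \<inter> B = {}" "A \<union> B = U" using U(2) by (auto simp: bipartition_def)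
  have "\<forall>m\<in>M. \<exists>h i0 j0 d \<sigma>. inj_on h ?W \<and> h ` ?W \<subseteq> verts G \<and>
    i0 < s \<and> j0 < ?N \<and>
    h (glue i0 j0) = (if d then fst m else snd m) \<and> h (glue i0 (Suc j0 mod ?N)) = (if d then snd m else fst m) \<and>
    (\<forall>i<s. \<sigma> i < ?N \<and> h (glue i (\<sigma> i)) \<in> L) \<and>
    (\<forall>i<s. \<forall>j<?N. \<not> (j = j0 \<and> (j0 = 0 \<or> i = i0)) \<longrightarrow>
      {h (glue i j), h (glue i (Suc j mod ?N))} \<in> edges G)" (is "\<forall>m\<in>M. ?P m")
  proof
    fix m assume "m \<in> M"
    then have m: "fst m \<in> A" "snd m \<in> B" "{fst m, snd m} \<notin> edges G" using M(1) by auto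
    show "?P m" using nonedge_signature[OF G k U m] unfolding L_def .
  qed
  then obtain h i0 j0 d \<sigma> where H: "\<forall>m\<in>M. inj_on (h m) ?W \<and> h m ` ?W \<subseteq> verts G \<and>
    i0 m < s \<and> j0 m < ?N \<and>
    h m (glue (i0 m) (j0 m)) = (if d m then fst m else snd m) \<and>
    h m (glue (i0 m) (Suc (j0 m) mod ?N)) = (if d m then snd m else fst m) \<and>
    (\<forall>i<s. \<sigma> m i < ?N \<and> h m (glue i (\<sigma> m i)) \<in> L) \<and>
    (\<forall>i<s. \<forall>j<?N. \<not> (j = j0 m \<and> (j0 m = 0 \<or> i = i0 m)) \<longrightarrow>
      {h m (glue i j), h m (glue i (Suc j mod ?N))} \<in> edges G)"
    unfolding bchoice_iff by blast
  have "glue 0 0 \<in> ?W" unfolding verts_F_graph using s by fastforce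
  then obtain c where c: "card M \<le> ?w ^ ?w * card {m \<in> M. \<forall>x\<in>?W. c (h m x) = x}"
    using ex_good_colouring[of "verts G" M ?W h] fin finM finite_verts_F_graph H
    unfolding copy_size_def by blast
  \<comment> \<open>Only pairs whose copies are compatible with \<open>c\<close> are kept: still a
    constant proportion of \<open>M\<close>, and splicing two of their copies stays
    injective.\<close>
  define I where "I = {m \<in> M. \<forall>x\<in>?W. c (h m x) = x}"
  define Sig where "Sig = {..<s} \<times> {..<?N} \<times> (UNIV :: bool set) \<times> ({..<s} \<rightarrow>\<^sub>E {..<?N}) \<times> ({..<s} \<rightarrow>\<^sub>E L)"
  define sig where "sig m = (i0 m, j0 m, d m, restrict (\<sigma> m) {..<s}, \<lambda>i\<in>{..<s}. h m (glue i (\<sigma> m i)))" for m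
  have finI: "finite I" using finM by (simp add: I_def)
  have finSig: "finite Sig"
    unfolding Sig_def L_def by (intro finite_cartesian_product finite_PiE) (use fin in auto)
  have cardSig: "card Sig = signature_count s k * card L ^ s"
    by (simp add: Sig_def card_cartesian_product card_PiE signature_count_def algebra_simps)
  have "sig ` I \<subseteq> Sig"
  proof (rule image_subsetI)
    fix m assume "m \<in> I"
    then have "m \<in> M" by (simp add: I_def)
    from bspec[OF H this] show "sig m \<in> Sig" by (simp add: Sig_def sig_def restrict_PiE_iff)
  qed
  then have "card I ^ 2 \<le> card Sig * card {(m, m'). m \<in> I \<and> m' \<in> I \<and> sig m = sig m'}"
    by (rule card_square_le_card_pairs[OF finI finSig])
  also have "card {(m, m'). m \<in> I \<and> m' \<in> I \<and> sig m = sig m'} \<le> card ?NE"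
  \<comment> \<open>Equal signatures make the crossed pair nonadjacent, and a crossed pair
    determines both matching pairs because \<open>fst\<close> and \<open>snd\<close> are injective
    on \<open>M\<close>.\<close>
  proof (rule card_inj_on_le[OF _ _ finNE])
    show "inj_on (\<lambda>(m, m'). (fst m, snd m')) {(m, m'). m \<in> I \<and> m' \<in> I \<and> sig m = sig m'}"
      using M(2,3) unfolding inj_on_def I_def by auto
    show "(\<lambda>(m, m'). (fst m, snd m')) ` {(m, m'). m \<in> I \<and> m' \<in> I \<and> sig m = sig m'} \<subseteq> ?NE"
    proof
      fix p assume "p \<in> (\<lambda>(m, m'). (fst m, snd m')) ` {(m, m'). m \<in> I \<and> m' \<in> I \<and> sig m = sig m'}"
      then obtain a b a' b' where p: "p = (a, b')"
        and m: "(a, b) \<in> I" "(a', b') \<in> I" and eq: "sig (a, b) = sig (a', b')"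
        by auto
      let ?m = "(a, b)" and ?m' = "(a', b')"
      have mM: "?m \<in> M" "?m' \<in> M" using m by (auto simp: I_def)
      note Hm = bspec[OF H mM(1)] and Hm' = bspec[OF H mM(2)]
      have eqs: "i0 ?m = i0 ?m'" "j0 ?m = j0 ?m'" "d ?m = d ?m'"
        using eq by (auto simp: sig_def)
      have r1: "restrict (\<sigma> ?m) {..<s} = restrict (\<sigma> ?m') {..<s}"
        and r2: "(\<lambda>i\<in>{..<s}. h ?m (glue i (\<sigma> ?m i))) = (\<lambda>i\<in>{..<s}. h ?m' (glue i (\<sigma> ?m' i)))"
        using eq by (auto simp: sig_def)
      have \<sigma>eq: "\<sigma> ?m i = \<sigma> ?m' i" if "i < s" for i using fun_cong[OF r1, of i] that by simp
      have heq: "h ?m (glue i (\<sigma> ?m i)) = h ?m' (glue i (\<sigma> ?m i))" if "i < s" for i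
        using fun_cong[OF r2, of i] that \<sigma>eq[OF that] by simp
      have abAB: "a \<in> A" "b \<in> B" "a' \<in> A" "b' \<in> B" using mM M(1) by auto
      then have notL: "a \<notin> L" "b \<notin> L" using AB(2) by (auto simp: L_def)
      have \<sigma>: "\<sigma> ?m i < ?N \<and> glue i (\<sigma> ?m i) \<noteq> glue (i0 ?m) (j0 ?m) \<and>
          glue i (\<sigma> ?m i) \<noteq> glue (i0 ?m) (Suc (j0 ?m) mod ?N)" if "i < s" for i
      proof -
        have "h ?m (glue i (\<sigma> ?m i)) \<in> L" "\<sigma> ?m i < ?N" using Hm that by blast+
        moreover have "h ?m (glue (i0 ?m) (j0 ?m)) \<notin> L" "h ?m (glue (i0 ?m) (Suc (j0 ?m) mod ?N)) \<notin> L"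
          using Hm notL by auto
        ultimately show ?thesis by metis
      qed
      have col: "c (h ?m x) = x \<and> c (h ?m' x) = x" if "x \<in> ?W" for x
        using m that by (auto simp: I_def)
      have vts: "h ?m x \<in> verts G \<and> h ?m' x \<in> verts G" if "x \<in> ?W" for x
      proof -
        have "h ?m ` ?W \<subseteq> verts G" "h ?m' ` ?W \<subseteq> verts G" using Hm Hm' by simp_all
        then show ?thesis using that by auto
      qed
      have edg: "{h ?m (glue i j), h ?m (glue i (Suc j mod ?N))} \<in> edges G \<and>
          {h ?m' (glue i j), h ?m' (glue i (Suc j mod ?N))} \<in> edges G"
        if "i < s" "j < ?N" "\<not> (j = j0 ?m \<and> (j0 ?m = 0 \<or> i = i0 ?m))" for i j
      proof
        show "{h ?m (glue i j), h ?m (glue i (Suc j mod ?N))} \<in> edges G"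
          using Hm that by simp
        show "{h ?m' (glue i j), h ?m' (glue i (Suc j mod ?N))} \<in> edges G"
          using Hm' that unfolding eqs by simp
      qed
      have ends: "i0 ?m < s" "j0 ?m < ?N" using Hm by simp_all
      have "{a, b'} \<notin> edges G"
      proof
        assume e: "{a, b'} \<in> edges G"
        have "contains_copy (F_graph s k) G"
        \<comment> \<open>The crossed edge joins the end \<open>a\<close> of the first copy to the
          end \<open>b'\<close> of the second; which copy supplies position \<open>j0\<close>
          depends on the direction \<open>d\<close>.\<close>
        proof (cases "d ?m")
          case True
          then have cross: "{h ?m (glue (i0 ?m) (j0 ?m)), h ?m' (glue (i0 ?m) (Suc (j0 ?m) mod ?N))} \<in> edges G"
            using Hm Hm' e eqs by simp
          show ?thesis
            by (rule contains_copy_mix[where h = "h ?m" and h' = "h ?m'" and c = c, OF ends _ _ _ _ _ cross]) (rule \<sigma> heq col vts edg; assumption)+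
        next
          case False
          then have cross: "{h ?m' (glue (i0 ?m) (j0 ?m)), h ?m (glue (i0 ?m) (Suc (j0 ?m) mod ?N))} \<in> edges G"
            using Hm Hm' e eqs by (simp add: insert_commute)
          show ?thesis
            by (rule contains_copy_mix[where h = "h ?m'" and h' = "h ?m" and c = c, OF ends _ _ _ _ _ cross])
              (rule \<sigma> heq[symmetric] col[THEN conj_commute[THEN iffD1]]
                vts[THEN conj_commute[THEN iffD1]] edg[THEN conj_commute[THEN iffD1]]; assumption)+
        qed
        then show False using G(2) by (simp add: maximal_F_free_def F_free_def)
      qed
      then show "p \<in> ?NE" using abAB p by simp
    qed
  qed
  finally have I2: "card I ^ 2 \<le> signature_count s k * card L ^ s * card ?NE"
    by (simp add: cardSig)
  have "card M ^ 2 \<le> (?w ^ ?w * card I) ^ 2"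
    using c unfolding I_def by (rule power_mono) simp
  also have "\<dots> = (?w ^ ?w) ^ 2 * card I ^ 2" by (simp add: power_mult_distrib)
  also have "\<dots> \<le> (?w ^ ?w) ^ 2 * (signature_count s k * card L ^ s * card ?NE)"
    using I2 by (rule mult_left_mono) simp
  finally show ?thesis unfolding L_def by (simp add: mult.assoc)
qed

section \<open>Near-extremal graphs\<close>

text \<open>A pair of \<open>R\<close> left uncovered could be added to \<open>M\<close>. When
  \<open>R\<close> lists the missing edges of a bipartite graph, deleting the covered vertices makes
  the rest complete.\<close>

lemma ex_maximal_matching:
  assumes "finite R"
  shows "\<exists>M\<subseteq>R. inj_on fst M \<and> inj_on snd M \<and> (\<forall>m\<in>R. fst m \<in> fst ` M \<or> snd m \<in> snd ` M)"
  using assms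
proof (induction R rule: finite_induct)
  case empty
  then show ?case by simp
next
  case (insert m R)
  then obtain M where M: "M \<subseteq> R" "inj_on fst M" "inj_on snd M"
    "\<forall>m\<in>R. fst m \<in> fst ` M \<or> snd m \<in> snd ` M"
    by blast
  show ?case
  proof (cases "fst m \<in> fst ` M \<or> snd m \<in> snd ` M")
    case True
    then show ?thesis using M by (intro exI[of _ M]) auto
  next
    case False
    moreover have "fst ` (M - {m}) \<subseteq> fst ` M" "snd ` (M - {m}) \<subseteq> snd ` M" by auto
    ultimately have "fst m \<notin> fst ` (M - {m})" "snd m \<notin> snd ` (M - {m})" by blast+
    then show ?thesis using M by (intro exI[of _ "insert m M"]) auto
  qed
qed

lemma powr_root_facts:
  fixes n s :: nat
  assumes "n \<ge> 1" "s \<ge> 1"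
  defines "p \<equiv> real n powr (1 / (real s + 1))"
  shows "p \<ge> 1" "p ^ s * p = real n" "real n powr ((real s + 2) / (real s + 1)) = real n * p" "p * p \<le> real n"
proof -
  have n: "real n \<ge> 1" using assms by simp
  show p1: "p \<ge> 1" unfolding p_def using n by (intro ge_one_powr_ge_zero) auto
  have "p ^ (s + 1) = real n powr (1 / (real s + 1) * real (s + 1))"
    unfolding p_def using n by (subst powr_realpow[symmetric]) (auto simp: powr_powr)
  also have "1 / (real s + 1) * real (s + 1) = 1" by (simp add: field_simps)
  finally show ps: "p ^ s * p = real n" using n by (simp add: mult.commute)
  have "(real s + 2) / (real s + 1) = 1 + 1 / (real s + 1)" by (simp add: field_simps)
  then show "real n powr ((real s + 2) / (real s + 1)) = real n * p"
    unfolding p_def using n by (simp add: powr_add)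
  have "p ^ 1 \<le> p ^ s" using p1 assms(2) by (intro power_increasing) auto
  then show "p * p \<le> real n" using ps p1 by (metis mult_right_mono power_one_right order_trans zero_le_one)
qed

text \<open>Here \<open>p\<close> is at most the square root of \<open>x\<close>; for positive
  \<open>D\<close> the outcome is used as \<open>p \<le> x / D\<close>.\<close>

lemma mult_le_of_square_le:
  fixes p x D :: real
  assumes "p * p \<le> x" "D ^ 2 \<le> x" "0 \<le> x"
  shows "p * D \<le> x"
proof (rule power2_le_imp_le)
  have "(p * D)\<^sup>2 = (p * p) * D\<^sup>2" by (simp add: power2_eq_square)
  also have "\<dots> \<le> x * x" using assms by (intro mult_mono) auto
  finally show "(p * D)\<^sup>2 \<le> x\<^sup>2" by (simp add: power2_eq_square)
qed (use assms in simp)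

text \<open>Part (a) with explicit constants. The deficit bounds both the missing edges of the
  bipartite core and the deleted vertices; \<open>nonedge_matching_bound\<close> then limits a
  maximal matching of missing edges to \<open>\<epsilon> * n / 4\<close> pairs, and removing its
  vertices leaves a complete bipartite graph.\<close>

lemma near_extremal_contains_large_complete_bipartite:
  fixes k s n :: nat and G :: "nat sgraph" and \<epsilon> \<gamma> p K :: real
  assumes k: "k \<ge> 2" and s: "s \<ge> 1"
    and \<epsilon>: "0 < \<epsilon>" "\<epsilon> \<le> 1 / 4"
    and K: "K = real ((copy_size s k ^ copy_size s k) ^ 2 * signature_count s k) + 1"
    and \<gamma>: "0 < \<gamma>" "\<gamma> \<le> 1" "32 * K * 800 ^ s * \<gamma> \<le> \<epsilon>\<^sup>2"
    and p: "1 \<le> p" "p ^ s * p = real n" "p * p \<le> real n"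
    and n: "n \<ge> 800 + 30 * (100 * (2 * k * s + 2 * k + 10))" "n \<ge> 10 ^ 6"
      "1 / 4 \<le> \<gamma> * real n" "(1600 / \<epsilon>)\<^sup>2 \<le> real n"
    and G: "graph_on n G" "maximal_F_free (F_graph s k) G"
    and e: "real (ex_number n (F_graph s k)) - \<gamma> * (real n * p) \<le> real (card (edges G))"
  shows "\<exists>S\<subseteq>verts G. complete_bipartite (induced G S) \<and> (1 - \<epsilon>) * real n \<le> real (card S)"
proof -
  define x where "x = real n"
  have x: "x \<ge> 10 ^ 6" using n(2) by (simp add: x_def)
  have simp: "simple_graph G" and cV: "card (verts G) = n" using G(1) by (auto simp: graph_on_def)
  have free: "F_free (F_graph s k) G" using G(2) by (simp add: maximal_F_free_def)
  have fin: "finite (verts G)" using simp by (simp add: simple_graph_def)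
  have small: "\<gamma> * (x * p) + 1 / 4 \<le> 2 * \<gamma> * (x * p)"
  proof -
    have "\<gamma> * x * 1 \<le> \<gamma> * x * p" using p(1) \<gamma>(1) x by (intro mult_left_mono) auto
    then have "\<gamma> * x \<le> \<gamma> * (x * p)" by (simp only: mult.assoc mult_1_right)
    then show ?thesis using n(3) unfolding x_def[symmetric] by linarith
  qed
  have low: "x\<^sup>2 / 4 - 2 * \<gamma> * (x * p) \<le> real (card (edges G))"
    using e ex_number_lower[OF s, of n k] small unfolding x_def by linarith
  have xp: "x * p \<le> x\<^sup>2 / 1000"
  proof -
    have "p * 1000 \<le> x" using mult_le_of_square_le[of p x 1000] p(3) x by (simp add: x_def)
    then have "x * (p * 1000) \<le> x * x" using x by (intro mult_left_mono) auto
    then show ?thesis by (simp add: power2_eq_square)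
  qed
  have "\<gamma> * (x * p) \<le> 1 * (x * p)" using \<gamma> p(1) x by (intro mult_right_mono) auto
  then have gxp: "2 * \<gamma> * (x * p) \<le> x\<^sup>2 / 500" using xp by linarith
  have x2: "x\<^sup>2 > 0" using x by simp
  \<comment> \<open>The deficit is at most \<open>x^2 / 500\<close>, and
    \<open>1 / 4 - 1 / 500\<close> exceeds \<open>99 / 400\<close>.\<close>
  have "\<not> real (card (edges G)) \<le> 99 / 400 * x\<^sup>2" using low gxp x2 by linarith
  then obtain U A B where U: "U \<subseteq> verts G" and AB: "bipartition (induced G U) A B"
    and le: "real (card (edges G)) \<le> real (card (edges (induced G U))) +
        (x\<^sup>2 - (real (card U))\<^sup>2) / 4 - x * (x - real (card U)) / 400"
    using F_free_structure[OF simp free k cV n(1)] unfolding x_def by blast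
  define u where "u = real (card U)"
  have simU: "simple_graph (induced G U)" using simple_induced[OF simp U] .
  let ?NE = "{(a, b). a \<in> A \<and> b \<in> B \<and> {a, b} \<notin> edges G}"
  have AB': "A \<union> B = U" "A \<inter> B = {}" using AB by (auto simp: bipartition_def)
  have NE_eq: "{(a, b). a \<in> A \<and> b \<in> B \<and> {a, b} \<notin> edges (induced G U)} = ?NE"
    using AB' by (auto simp: edges_induced)
  have finAB: "finite A" "finite B" and cAB: "card A + card B = card U"
    using bipartition_card_verts[OF simU AB] by auto
  have finNE: "finite ?NE" by (rule finite_subset[of _ "A \<times> B"]) (use finAB in auto)
  define ne where "ne = real (card ?NE)"
  have eU: "real (card (edges (induced G U))) + ne = real (card A) * real (card B)"
    using bipartition_card_edges[OF simU AB] unfolding NE_eq ne_def by (simp flip: of_nat_add of_nat_mult)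
  have "real (card A) + real (card B) = u" using cAB by (simp add: u_def flip: of_nat_add)
  then have mult_le: "4 * (real (card A) * real (card B)) \<le> u\<^sup>2"
    using four_mult_le_square[of "real (card A)" "real (card B)"] by simp
  have "card U \<le> n" unfolding cV[symmetric] by (rule card_mono[OF fin U])
  then have ux: "u \<le> x" by (simp add: u_def x_def)
  \<comment> \<open>The core has at most \<open>u^2 / 4 - ne\<close> edges, so both losses together
    have to fit into the deficit from \<open>x^2 / 4\<close>.\<close>
  have "ne + x * (x - u) / 400 \<le> 2 * \<gamma> * (x * p)"
    using low le eU mult_le unfolding u_def by (simp add: field_simps)
  moreover have "0 \<le> ne" "0 \<le> x * (x - u) / 400" using ux x by (auto simp: ne_def)
  ultimately have ne: "ne \<le> 2 * \<gamma> * (x * p)" and xu': "x * (x - u) / 400 \<le> 2 * \<gamma> * (x * p)"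
    by linarith+
  have xu: "x - u \<le> 800 * \<gamma> * p"
  proof -
    have "x * (x - u) \<le> x * (800 * \<gamma> * p)" using xu' by (simp add: algebra_simps)
    then show ?thesis using x by (simp add: mult_le_cancel_left)
  qed
  obtain M where M: "M \<subseteq> ?NE" "inj_on fst M" "inj_on snd M"
    and max: "\<forall>m\<in>?NE. fst m \<in> fst ` M \<or> snd m \<in> snd ` M"
    using ex_maximal_matching[OF finNE] by blast
  have finM: "finite M" using M(1) finNE by (rule finite_subset)
  define L where "L = real (card (verts G - U))"
  have L: "L = x - u" "0 \<le> L"
    using U fin cV \<open>card U \<le> n\<close> by (auto simp: L_def x_def u_def card_Diff_subset finite_subset of_nat_diff)
  have k1: "k \<ge> 1" using k by simp
  have "real (card M ^ 2) \<le> real ((copy_size s k ^ copy_size s k) ^ 2 *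
      (signature_count s k * card (verts G - U) ^ s) * card ?NE)"
    using nonedge_matching_bound[OF simp G(2) k1 s U AB M] by (rule of_nat_mono)
  also have "\<dots> = (K - 1) * L ^ s * ne"
    unfolding K ne_def L_def by simp
  also have "\<dots> \<le> K * (800 * \<gamma> * p) ^ s * (2 * \<gamma> * (x * p))"
    using L xu ne \<open>0 \<le> ne\<close> \<gamma> p K by (intro mult_mono power_mono mult_nonneg_nonneg) auto
  \<comment> \<open>The exponent \<open>(s + 2) / (s + 1)\<close> is decided here: \<open>s\<close>
    factors \<open>p\<close> come from the vertices outside \<open>U\<close> and one from the number
    of missing edges, and their product is \<open>n\<close>.\<close>
  also have "\<dots> = 2 * K * 800 ^ s * \<gamma> * \<gamma> ^ s * (p ^ s * p) * x"
    by (simp add: power_mult_distrib)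
  also have "\<dots> = 2 * K * 800 ^ s * \<gamma> * \<gamma> ^ s * x\<^sup>2"
    using p(2) by (simp add: x_def power2_eq_square)
  also have "\<dots> \<le> 2 * K * 800 ^ s * \<gamma> * 1 * x\<^sup>2"
    using \<gamma> K by (intro mult_right_mono mult_left_mono power_le_one mult_nonneg_nonneg) auto
  also have "\<dots> = (32 * K * 800 ^ s * \<gamma>) * x\<^sup>2 / 16" by simp
  also have "\<dots> \<le> \<epsilon>\<^sup>2 * x\<^sup>2 / 16" using \<gamma>(3) by (intro divide_right_mono mult_right_mono) auto
  also have "\<dots> = (\<epsilon> * x / 4)\<^sup>2" by (simp add: power_mult_distrib power_divide)
  finally have "(real (card M))\<^sup>2 \<le> (\<epsilon> * x / 4)\<^sup>2" by simp
  then have cM: "real (card M) \<le> \<epsilon> * x / 4"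
    by (rule power2_le_imp_le) (use \<epsilon> x in simp)
  define S where "S = U - (fst ` M \<union> snd ` M)"
  have pe: "800 * \<gamma> * p \<le> \<epsilon> * x / 2"
  proof -
    have "p * (1600 / \<epsilon>) \<le> x" using mult_le_of_square_le[of p x "1600 / \<epsilon>"] p(3) n(4) by (simp add: x_def)
    then have "1600 * p \<le> \<epsilon> * x" using \<epsilon> by (simp add: field_simps)
    moreover have "\<gamma> * p \<le> 1 * p" using \<gamma> p by (intro mult_right_mono) auto
    ultimately show ?thesis by linarith
  qed
  have "card (fst ` M \<union> snd ` M) \<le> 2 * card M"
    using card_Un_le[of "fst ` M" "snd ` M"] card_image_le[OF finM, of fst] card_image_le[OF finM, of snd] by linarith
  moreover have "card U \<le> card S + card (fst ` M \<union> snd ` M)"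
    unfolding S_def using diff_card_le_card_Diff[of "fst ` M \<union> snd ` M" U] finM by (simp add: le_diff_conv)
  ultimately have "card U \<le> card S + 2 * card M" by linarith
  then have "real (card U) \<le> real (card S) + 2 * real (card M)" by linarith
  then have cS: "(1 - \<epsilon>) * x \<le> real (card S)"
    using cM xu pe unfolding u_def by (simp add: algebra_simps)
  \<comment> \<open>Both parts are too large to be swallowed by the at most \<open>x / 16\<close>
    matched vertices on one side.\<close>
  have big: "x\<^sup>2 / 10 < real (card A) * real (card B)"
  proof -
    have "\<epsilon> * x \<le> 1 / 4 * x" using \<epsilon> x by (intro mult_right_mono) auto
    then have "x * (7 / 8) \<le> u" using xu pe by simp
    then have "(x * (7 / 8))\<^sup>2 \<le> u\<^sup>2" by (rule power_mono) (use x in simp)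
    then have "x\<^sup>2 * (49 / 64) \<le> u\<^sup>2" by (simp add: power_mult_distrib power_divide)
    moreover have "0 \<le> x * (x - real (card U)) / 400" using ux x by (simp add: u_def)
    moreover have "c / 10 < ab" if "c * (49 / 64) \<le> d" "0 \<le> q" "c / 4 - w \<le> f"
        "f \<le> g + (c - d) / 4 - q" "g + h = ab" "0 \<le> h" "w \<le> c / 500" "0 < c"
      for c d q w f g h ab :: real
      using that by (simp add: field_simps)
    ultimately show ?thesis using low le eU \<open>0 \<le> ne\<close> gxp x2 unfolding u_def by blast
  qed
  have cAB_le: "real (card A) \<le> x" "real (card B) \<le> x"
    using cAB \<open>card U \<le> n\<close> by (auto simp: x_def)
  have cM': "real (card M) \<le> x / 16"
  proof -
    have "\<epsilon> * x \<le> 1 / 4 * x" using \<epsilon> x by (intro mult_right_mono) auto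
    then show ?thesis using cM by simp
  qed
  have neA: "A \<inter> S \<noteq> {}"
  proof
    assume "A \<inter> S = {}"
    then have "A \<subseteq> fst ` M" using M(1) AB' by (force simp: S_def)
    then have "card A \<le> card M" using finM by (meson card_image_le card_mono finite_imageI le_trans)
    then have "real (card A) * real (card B) \<le> (x / 16) * x"
      using cM' cAB_le by (intro mult_mono) auto
    then show False using big x2 by (simp add: power2_eq_square)
  qed
  have neB: "B \<inter> S \<noteq> {}"
  proof
    assume "B \<inter> S = {}"
    then have "B \<subseteq> snd ` M" using M(1) AB' by (force simp: S_def)
    then have "card B \<le> card M" using finM by (meson card_image_le card_mono finite_imageI le_trans)
    then have "real (card A) * real (card B) \<le> x * (x / 16)"
      using cM' cAB_le by (intro mult_mono) auto
    then show False using big x2 by (simp add: power2_eq_square)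
  qed
  have "complete_bipartite (induced G S)"
    unfolding complete_bipartite_def
  proof (intro exI conjI)
    show "A \<inter> S \<noteq> {}" "B \<inter> S \<noteq> {}" by fact+
    show "A \<inter> S \<inter> (B \<inter> S) = {}" using AB' by blast
    show "verts (induced G S) = A \<inter> S \<union> B \<inter> S" using AB' by (auto simp: S_def)
    show "edges (induced G S) = {{a, b} |a b. a \<in> A \<inter> S \<and> b \<in> B \<inter> S}"
    proof (intro set_eqI iffI)
      fix f assume f: "f \<in> edges (induced G S)"
      then have "f \<in> edges (induced G U)" by (auto simp: edges_induced S_def)
      then obtain a b where "a \<in> A" "b \<in> B" "f = {a, b}" using AB by (auto simp: bipartition_def)
      then show "f \<in> {{a, b} |a b. a \<in> A \<inter> S \<and> b \<in> B \<inter> S}" using f by (auto simp: edges_induced)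
    next
      fix f assume "f \<in> {{a, b} |a b. a \<in> A \<inter> S \<and> b \<in> B \<inter> S}"
      then obtain a b where f: "f = {a, b}" "a \<in> A" "b \<in> B" "a \<in> S" "b \<in> S" by blast
      have "{a, b} \<in> edges G"
      proof (rule ccontr)
        assume "{a, b} \<notin> edges G"
        then have "(a, b) \<in> ?NE" using f by simp
        from bspec[OF max this] show False using f by (auto simp: S_def)
      qed
      then show "f \<in> edges (induced G S)" using f by (simp add: edges_induced)
    qed
  qed
  moreover have "S \<subseteq> verts G" using U by (auto simp: S_def)
  ultimately show ?thesis using cS unfolding x_def by blast
qed

lemma stability:
  fixes k s :: nat
  assumes k: "k \<ge> 2" and s: "s \<ge> 1" and "\<beta> > (0::real)"
  shows "\<exists>\<gamma>::real. \<gamma> > 0 \<and> (\<exists>n0::nat. \<forall>n\<ge>n0. \<forall>G::nat sgraph.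
    graph_on n G \<longrightarrow> maximal_F_free (F_graph s k) G \<longrightarrow>
    real (card (edges G)) \<ge> real (ex_number n (F_graph s k))
        - \<gamma> * real n powr ((real s + 2) / (real s + 1)) \<longrightarrow>
    (\<exists>S\<subseteq>verts G. complete_bipartite (induced G S) \<and> real (card S) \<ge> (1 - \<beta>) * real n))"
proof -
  define \<epsilon> where "\<epsilon> = min \<beta> (1 / 4)"
  have \<epsilon>: "0 < \<epsilon>" "\<epsilon> \<le> 1 / 4" "\<epsilon> \<le> \<beta>" using assms(3) by (auto simp: \<epsilon>_def)
  define K where "K = real ((copy_size s k ^ copy_size s k) ^ 2 * signature_count s k) + 1"
  have K: "K > 0" unfolding K_def by (rule add_nonneg_pos) auto
  \<comment> \<open>The factor \<open>32\<close> leaves \<open>2 * K * 800 ^ s * \<gamma>\<close> at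
    most \<open>\<epsilon>^2 / 16\<close>, as needed for a matching of size
    \<open>\<epsilon> * n / 4\<close>.\<close>
  define \<gamma> where "\<gamma> = min 1 (\<epsilon>\<^sup>2 / (32 * K * 800 ^ s))"
  have \<gamma>: "0 < \<gamma>" "\<gamma> \<le> 1" using \<epsilon>(1) K by (auto simp: \<gamma>_def)
  have "\<gamma> \<le> \<epsilon>\<^sup>2 / (32 * K * 800 ^ s)" by (simp add: \<gamma>_def)
  then have \<gamma>K: "32 * K * 800 ^ s * \<gamma> \<le> \<epsilon>\<^sup>2" using K by (simp add: field_simps)
  define n0 where "n0 = max (800 + 30 * (100 * (2 * k * s + 2 * k + 10)))
    (max (10 ^ 6) (max (nat \<lceil>1 / (4 * \<gamma>)\<rceil>) (nat \<lceil>(1600 / \<epsilon>)\<^sup>2\<rceil>)))"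
  show ?thesis
  proof (rule exI[of _ \<gamma>], rule conjI[OF \<gamma>(1)], rule exI[of _ n0], intro allI impI)
    fix n :: nat and G :: "nat sgraph"
    assume n: "n0 \<le> n" and G: "graph_on n G" "maximal_F_free (F_graph s k) G"
      and e: "real (ex_number n (F_graph s k)) - \<gamma> * real n powr ((real s + 2) / (real s + 1)) \<le> real (card (edges G))"
    have n1: "n \<ge> 800 + 30 * (100 * (2 * k * s + 2 * k + 10))" "n \<ge> 10 ^ 6"
      "nat \<lceil>1 / (4 * \<gamma>)\<rceil> \<le> n" "nat \<lceil>(1600 / \<epsilon>)\<^sup>2\<rceil> \<le> n"
      using n unfolding n0_def by (auto simp only: max.bounded_iff)
    have n2: "1 / (4 * \<gamma>) \<le> real n" "(1600 / \<epsilon>)\<^sup>2 \<le> real n"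
      using n1(3,4) by (simp_all only: nat_le_iff ceiling_le_iff of_int_of_nat_eq)
    have n3: "1 / 4 \<le> \<gamma> * real n" using n2(1) \<gamma>(1) by (simp add: field_simps)
    have "n \<ge> 1" using n1(2) by simp
    note p = powr_root_facts[OF this s]
    have "\<exists>S\<subseteq>verts G. complete_bipartite (induced G S) \<and> (1 - \<epsilon>) * real n \<le> real (card S)"
      by (rule near_extremal_contains_large_complete_bipartite[OF k s \<epsilon>(1,2) K_def \<gamma> \<gamma>K p(1,2,4) n1(1,2) n3 n2(2) G])
        (use e p(3) in simp)
    moreover have "(1 - \<beta>) * real n \<le> (1 - \<epsilon>) * real n" using \<epsilon>(3) by (intro mult_right_mono) auto
    ultimately show "\<exists>S\<subseteq>verts G. complete_bipartite (induced G S) \<and> (1 - \<beta>) * real n \<le> real (card S)"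
      by (meson order_trans)
  qed
qed

section \<open>A near-extremal graph without large complete bipartite subgraphs\<close>

text \<open>The steps of a closed walk in the integers mod \<open>N\<close> add up to a multiple of
  \<open>N\<close>. With \<open>q\<close> downward steps the sum is \<open>N - 2 * q\<close>, and
  since \<open>N\<close> is odd it divides \<open>q\<close>, which is therefore \<open>0\<close> or
  \<open>N\<close>.\<close>

lemma monotone_closed_walk:
  fixes lev :: "nat \<Rightarrow> nat" and up :: "nat \<Rightarrow> bool"
  assumes "N = 2 * k + 1"
    and up: "\<And>j. j < N \<Longrightarrow> up j \<Longrightarrow> lev (Suc j mod N) = Suc (lev j) mod N"
    and down: "\<And>j. j < N \<Longrightarrow> \<not> up j \<Longrightarrow> lev j = Suc (lev (Suc j mod N)) mod N"
  shows "(\<forall>j<N. up j) \<or> (\<forall>j<N. \<not> up j)"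
proof -
  define d :: "nat \<Rightarrow> int" where "d j = (if up j then 1 else -1)" for j
  have dvd: "int N dvd int (lev (Suc j mod N)) - int (lev j) - d j" if "j < N" for j
  proof (cases "up j")
    case True
    have "int (Suc (lev j) mod N) = (int (lev j) + 1) mod int N" by (simp add: zmod_int add.commute)
    then show ?thesis using up[OF that True] True
      by (simp add: d_def mod_eq_dvd_iff[symmetric] diff_diff_eq)
  next
    case False
    have "int (Suc (lev (Suc j mod N)) mod N) = (int (lev (Suc j mod N)) + 1) mod int N"
      by (simp add: zmod_int add.commute)
    then have "int N dvd (int (lev (Suc j mod N)) + 1) - int (lev j)"
      using down[OF that False] by (metis mod_eq_dvd_iff mod_mod_trivial)
    then show ?thesis using False by (simp add: d_def algebra_simps)
  qed
  have N: "N > 0" using assms(1) by simp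
  have "(\<Sum>j<N. int (lev (Suc j mod N))) = (\<Sum>j<N. int (lev j))"
  proof (rule sum.reindex_bij_betw)
    have "inj_on (\<lambda>j. Suc j mod N) {..<N}"
    proof (rule inj_onI)
      fix x y assume "x \<in> {..<N}" "y \<in> {..<N}" "Suc x mod N = Suc y mod N"
      then show "x = y" by (cases "Suc x = N"; cases "Suc y = N") auto
    qed
    moreover from this have "(\<lambda>j. Suc j mod N) ` {..<N} = {..<N}"
      by (rule endo_inj_surj[rotated 2]) (use N in auto)
    ultimately show "bij_betw (\<lambda>j. Suc j mod N) {..<N} {..<N}" by (simp add: bij_betw_def)
  qed
  then have "(\<Sum>j<N. int (lev (Suc j mod N)) - int (lev j) - d j) = - (\<Sum>j<N. d j)"
    by (simp add: sum_subtractf)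
  moreover have "int N dvd (\<Sum>j<N. int (lev (Suc j mod N)) - int (lev j) - d j)"
    by (rule dvd_sum) (use dvd in auto)
  ultimately have dvd_d: "int N dvd (\<Sum>j<N. d j)" by simp
  define q where "q = card {j \<in> {..<N}. \<not> up j}"
  have "(\<Sum>j<N. d j) = (\<Sum>j<N. 1 - 2 * (if \<not> up j then 1 else 0))"
    by (rule sum.cong) (auto simp: d_def)
  also have "\<dots> = int N - 2 * (\<Sum>j<N. if \<not> up j then 1 else 0)"
    by (simp add: sum_subtractf sum_distrib_left)
  also have "(\<Sum>j<N. if \<not> up j then 1 else 0) = int q"
    unfolding q_def by (subst sum.inter_filter[symmetric]) auto
  finally have "int N dvd int N - 2 * int q" using dvd_d by simp
  then have "int N dvd 2 * int q" using dvd_diff[of "int N" "int N" "int N - 2 * int q"] by simp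
  moreover have "coprime (int N) 2" using assms(1) by simp
  ultimately have "N dvd q" by (simp add: coprime_dvd_mult_right_iff)
  moreover have "{j \<in> {..<N}. \<not> up j} \<subseteq> {..<N}" by auto
  from card_mono[OF finite_lessThan this] have "q \<le> N" by (simp add: q_def)
  ultimately have "q = 0 \<or> q = N" by (meson dvd_imp_le le_antisym not_gr_zero)
  then show ?thesis
  proof
    assume "q = 0"
    then have "{j \<in> {..<N}. \<not> up j} = {}" unfolding q_def by simp
    then show ?thesis by blast
  next
    assume "q = N"
    then have "{j \<in> {..<N}. \<not> up j} = {..<N}" unfolding q_def by (intro card_subset_eq) auto
    then show ?thesis by blast
  qed
qed

section \<open>Digits and cells\<close>

definition digit :: "nat \<Rightarrow> nat \<Rightarrow> nat \<Rightarrow> nat" where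
  "digit t i x = (x div t ^ i) mod t"

lemma mod_power_eq_of_digits:
  assumes "\<And>i. i < s \<Longrightarrow> digit t i x = digit t i y"
  shows "x mod t ^ s = y mod t ^ s"
  using assms
proof (induction s)
  case (Suc s)
  have "x mod t ^ Suc s = t ^ s * digit t s x + x mod t ^ s" for x
    using mod_mult2_eq[of x "t ^ s" t] by (simp add: digit_def mult.commute)
  then show ?case using Suc by simp
qed simp

text \<open>The digits compared are the lowest \<open>s\<close> ones in base \<open>t\<close>, so
  among the first \<open>M\<close> indices a cell is a residue class mod
  \<open>t ^ s\<close>.\<close>

definition same_cell :: "nat \<Rightarrow> nat \<Rightarrow> nat \<Rightarrow> nat \<Rightarrow> nat \<Rightarrow> bool" where
  "same_cell s t M x y \<longleftrightarrow> x < M \<and> y < M \<and> (\<forall>i<s. digit t i x = digit t i y)"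

text \<open>Each residue class mod \<open>t ^ s\<close> has \<open>m\<close> members below
  \<open>m * t ^ s\<close>.\<close>

lemma card_same_cell:
  assumes "t \<ge> 1"
  shows "card {(x, y). same_cell s t (m * t ^ s) x y} \<le> m * t ^ s * m"
proof -
  let ?M = "m * t ^ s"
  let ?C = "\<lambda>x. {y. y < ?M \<and> y mod t ^ s = x mod t ^ s}"
  have pos: "t ^ s > 0" using assms by simp
  have C: "card (?C x) \<le> m" for x
  proof -
    have "inj_on (\<lambda>y. y div t ^ s) (?C x)"
    proof (rule inj_onI)
      fix y z assume "y \<in> ?C x" "z \<in> ?C x" and eq: "y div t ^ s = z div t ^ s"
      then have "y mod t ^ s = z mod t ^ s" by simp
      then show "y = z" using eq by (metis div_mult_mod_eq)
    qed
    moreover have "(\<lambda>y. y div t ^ s) ` ?C x \<subseteq> {..<m}"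
      by (auto simp: less_mult_imp_div_less)
    ultimately have "card (?C x) \<le> card {..<m}" by (rule card_inj_on_le) simp
    then show ?thesis by simp
  qed
  have "{(x, y). same_cell s t ?M x y} \<subseteq> (SIGMA x:{..<?M}. ?C x)"
  proof (rule subrelI)
    fix x y assume "(x, y) \<in> {(x, y). same_cell s t ?M x y}"
    then have "x < ?M" "y < ?M" "y mod t ^ s = x mod t ^ s"
      using mod_power_eq_of_digits[of s t y x] by (simp_all add: same_cell_def)
    then show "(x, y) \<in> (SIGMA x:{..<?M}. ?C x)" by simp
  qed
  then have "card {(x, y). same_cell s t ?M x y} \<le> card (SIGMA x:{..<?M}. ?C x)"
    by (rule card_mono[rotated]) auto
  also have "\<dots> = (\<Sum>x<?M. card (?C x))" by (rule card_SigmaI) auto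
  also have "\<dots> \<le> (\<Sum>x<?M. m)" by (intro sum_mono C)
  finally show ?thesis by simp
qed

section \<open>The layered graph with digit paths\<close>

text \<open>\<open>a\<close> and \<open>b\<close> are the sizes of the two big parts, whose first
  \<open>m * t ^ s\<close> vertices carry digits; each digit vector is carried by \<open>m\<close>
  vertices of either part.\<close>

locale gadget =
  fixes s t m k a b :: nat
  assumes k: "k \<ge> 2" and s: "s \<ge> 2" and t: "t \<ge> 1"
    and M_le: "m * t ^ s \<le> a" "m * t ^ s \<le> b"
begin

abbreviation "M \<equiv> m * t ^ s"

text \<open>A vertex is a triple whose first component is its level \<open>0, \<dots>, 2k\<close>; levels \<open>0\<close> and \<open>2k\<close> are the
  two big parts, and for \<open>i < s\<close>, \<open>j < t\<close> the vertices \<open>(l, i, j)\<close> with \<open>0 < l < 2k\<close> form a path.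
  Arcs lead from one level to the next one, cyclically.\<close>

definition arc :: "nat \<times> nat \<times> nat \<Rightarrow> nat \<times> nat \<times> nat \<Rightarrow> bool" where
  "arc = (\<lambda>(l, i, j) (l', i', j').
    l = 2 * k \<and> l' = 0 \<and> i < b \<and> i' < a \<and> j = 0 \<and> j' = 0 \<and> \<not> same_cell s t M i' i \<or>
    l = 0 \<and> l' = 1 \<and> i < M \<and> j = 0 \<and> i' < s \<and> j' = digit t i' i \<or>
    1 \<le> l \<and> l' = Suc l \<and> l' < 2 * k \<and> i < s \<and> j < t \<and> i' = i \<and> j' = j \<or>
    Suc l = 2 * k \<and> l' = 2 * k \<and> i' < M \<and> j' = 0 \<and> i < s \<and> j = digit t i i')"

definition V :: "(nat \<times> nat \<times> nat) set" where
  "V = {0} \<times> {..<a} \<times> {0} \<union> {2 * k} \<times> {..<b} \<times> {0} \<union> {1..<2 * k} \<times> {..<s} \<times> {..<t}"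

definition gr :: "(nat \<times> nat \<times> nat) sgraph" where
  "gr = (V, {{u, v} | u v. arc u v})"

lemma arc_level: "arc u v \<Longrightarrow> fst u < 2 * k + 1 \<and> fst v = Suc (fst u) mod (2 * k + 1)"
  using k by (cases u; cases v) (auto simp: arc_def)

lemma arc_verts:
  assumes "arc u v"
  shows "u \<in> V" "v \<in> V"
proof -
  have "digit t i x < t" for i x using t by (simp add: digit_def)
  then show "u \<in> V" "v \<in> V"
    using assms M_le k by (cases u; cases v; fastforce simp: arc_def V_def)+
qed

lemma arc_irrefl: "arc u v \<Longrightarrow> u \<noteq> v"
  using k by (cases u) (auto simp: arc_def)

lemma simple_gr: "simple_graph gr"
proof -
  have "card {u, v} = 2" if "arc u v" for u v using arc_irrefl[OF that] by simp
  then show ?thesis by (auto simp: simple_graph_def gr_def V_def dest: arc_verts[unfolded V_def])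
qed

lemma card_V: "card V = a + b + (2 * k - 1) * (s * t)"
proof -
  have "card V = card ({0::nat} \<times> {..<a} \<times> {0::nat} \<union> {2 * k} \<times> {..<b} \<times> {0}) + card ({1..<2 * k} \<times> {..<s} \<times> {..<t})"
    unfolding V_def using k by (intro card_Un_disjoint) auto
  also have "card ({0::nat} \<times> {..<a} \<times> {0::nat} \<union> {2 * k} \<times> {..<b} \<times> {0}) = a + b"
    using k by (subst card_Un_disjoint) (auto simp: card_cartesian_product)
  finally show ?thesis by (simp add: card_cartesian_product)
qed

text \<open>Only edges between the two big parts are counted; the pairs missing there are those in a
  common cell.\<close>

lemma card_edges_gr: "a * b \<le> card (edges gr) + M * m"
proof -
  let ?P = "{(x, y). x < a \<and> y < b \<and> \<not> same_cell s t M x y}"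
  let ?Q = "{(x, y). same_cell s t M x y}"
  have fin: "finite ?P" "finite ?Q"
    by (rule finite_subset[of _ "{..<a} \<times> {..<b}"]; use M_le in \<open>auto simp: same_cell_def\<close>)+
  have "{..<a} \<times> {..<b} \<subseteq> ?P \<union> ?Q" by auto
  then have "card ({..<a} \<times> {..<b}) \<le> card (?P \<union> ?Q)" using fin by (intro card_mono) auto
  also have "\<dots> \<le> card ?P + card ?Q" by (rule card_Un_le)
  finally have "a * b \<le> card ?P + card ?Q" by (simp add: card_cartesian_product)
  moreover have "card ?Q \<le> M * m" using card_same_cell[OF t] .
  moreover have "card ?P \<le> card (edges gr)"
  proof (rule card_inj_on_le)
    show "inj_on (\<lambda>(x, y). {(2 * k, y, 0), (0, x, 0)}) ?P"
      using k by (auto simp: inj_on_def doubleton_eq_iff)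
    show "(\<lambda>(x, y). {(2 * k, y, 0), (0, x, 0)}) ` ?P \<subseteq> edges gr"
    proof clarify
      fix x y assume "x < a" "y < b" "\<not> same_cell s t M x y"
      then have "arc (2 * k, y, 0) (0, x, 0)" by (simp add: arc_def)
      then show "{(2 * k, y, 0), (0, x, 0)} \<in> edges gr" unfolding gr_def snd_conv by blast
    qed
    show "finite (edges gr)" using finite_edges[OF simple_gr] .
  qed
  ultimately show ?thesis by linarith
qed

text \<open>Along a directed cycle the level rises by one at each step, so every level is met once.
  Its position is the same on all cycles because these start at the same vertex.\<close>

lemma level_parametrisation:
  assumes arcs: "\<And>i j. i < s \<Longrightarrow> j < 2 * k + 1 \<Longrightarrow> arc (c i j) (c i (Suc j mod (2 * k + 1)))"
    and start: "\<And>i. i < s \<Longrightarrow> c i 0 = c 0 0"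
  shows "\<exists>\<pi>. (\<forall>l<2*k+1. \<pi> l < 2*k+1) \<and> (\<forall>i<s. \<forall>l<2*k+1.
    fst (c i (\<pi> l)) = l \<and> arc (c i (\<pi> l)) (c i (\<pi> (Suc l mod (2*k+1)))))"
proof -
  define N where "N = 2 * k + 1"
  have N: "N > 0" by (simp add: N_def)
  define l0 where "l0 = fst (c 0 0)"
  have l0: "l0 < N" using arc_level[OF arcs[of 0 0]] s by (simp add: l0_def N_def)
  have lev: "fst (c i j) = (l0 + j) mod N" if "i < s" "j < N" for i j
    using that(2)
  proof (induction j)
    case 0
    then show ?case using start[OF that(1)] l0 by (simp add: l0_def)
  next
    case (Suc j)
    then have "fst (c i (Suc j mod N)) = Suc (fst (c i j)) mod N"
      using arc_level[OF arcs[OF that(1), of j]] by (simp add: N_def)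
    then show ?case using Suc by (simp add: mod_Suc_eq)
  qed
  define \<pi> where "\<pi> l = (l + (N - l0)) mod N" for l
  have \<pi>N: "\<pi> l < N" for l using N by (simp add: \<pi>_def)
  have "fst (c i (\<pi> l)) = l" if "i < s" "l < N" for i l
  proof -
    have "fst (c i (\<pi> l)) = (l0 + (l + (N - l0)) mod N) mod N"
      using lev[OF that(1) \<pi>N] by (simp add: \<pi>_def)
    also have "\<dots> = (l0 + (l + (N - l0))) mod N" by (rule mod_add_right_eq)
    also have "l0 + (l + (N - l0)) = l + N" using l0 by simp
    finally show ?thesis using that by simp
  qed
  moreover have "\<pi> (Suc l mod N) = Suc (\<pi> l) mod N" for l
    unfolding \<pi>_def by (simp add: mod_add_left_eq mod_Suc_eq)
  ultimately show ?thesis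
    using arcs \<pi>N unfolding N_def[symmetric] by (intro exI[of _ \<pi>]) auto
qed

text \<open>By \<open>monotone_closed_walk\<close> a cycle follows the arcs throughout or runs
  against them throughout, and the shared edge forces the same direction on all cycles.\<close>

lemma copy_levels:
  assumes emb: "\<And>i j. i < s \<Longrightarrow> j < 2*k+1 \<Longrightarrow> {h (glue i j), h (glue i (Suc j mod (2*k+1)))} \<in> edges gr"
  shows "\<exists>\<pi>. (\<forall>l<2*k+1. \<pi> l < 2*k+1) \<and> (\<forall>i<s. \<forall>l<2*k+1.
    fst (h (glue i (\<pi> l))) = l \<and> arc (h (glue i (\<pi> l))) (h (glue i (\<pi> (Suc l mod (2*k+1))))))"
proof -
  define N where "N = 2 * k + 1"
  let ?up = "\<lambda>i j. arc (h (glue i j)) (h (glue i (Suc j mod N)))"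
  have down: "arc (h (glue i (Suc j mod N))) (h (glue i j))" if "i < s" "j < N" "\<not> ?up i j" for i j
    using emb[of i j] that unfolding gr_def N_def[symmetric] by (auto simp: doubleton_eq_iff)
  have mono: "(\<forall>j<N. ?up i j) \<or> (\<forall>j<N. \<not> ?up i j)" if i: "i < s" for i
  proof (rule monotone_closed_walk[where lev = "\<lambda>j. fst (h (glue i j))" and k = k])
    show "N = 2 * k + 1" by (simp add: N_def)
    fix j assume j: "j < N"
    show "fst (h (glue i (Suc j mod N))) = Suc (fst (h (glue i j))) mod N" if "?up i j"
      using arc_level[OF that] by (simp add: N_def)
    show "fst (h (glue i j)) = Suc (fst (h (glue i (Suc j mod N)))) mod N" if "\<not> ?up i j"
      using arc_level[OF down[OF i j that]] by (simp add: N_def)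
  qed
  have N: "N > 1" using k by (simp add: N_def)
  have shared: "glue i 0 = (0, 0)" "glue i (Suc 0 mod N) = (0, 1)" for i
    using N by (simp_all add: glue_def)
  show ?thesis
  proof (cases "?up 0 0")
    case True
    have "?up i 0" if "i < s" for i using True by (simp only: shared)
    then have "?up i j" if "i < s" "j < N" for i j using mono[OF that(1)] that N by (metis less_trans zero_less_one)
    then show ?thesis
      by (intro level_parametrisation[where c = "\<lambda>i j. h (glue i j)"]) (simp_all add: N_def glue_def)
  next
    case False
    have "\<not> ?up i 0" if "i < s" for i using False by (simp only: shared) simp
    then have nup: "\<not> ?up i j" if "i < s" "j < N" for i j using mono[OF that(1)] that N by (metis less_trans zero_less_one)
    \<comment> \<open>Reversal of the cycles, fixing position \<open>0\<close>, turns backward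
      cycles into directed ones.\<close>
    define \<rho> where "\<rho> j = (N - j) mod N" for j
    have \<rho>: "\<rho> j < N" "Suc (\<rho> (Suc j mod N)) mod N = \<rho> j" if "j < N" for j
    proof -
      show "\<rho> j < N" using N by (simp add: \<rho>_def)
      show "Suc (\<rho> (Suc j mod N)) mod N = \<rho> j"
      proof (cases "Suc j = N")
        case True
        then have "N - j = 1" by simp
        then show ?thesis using True N by (simp add: \<rho>_def)
      next
        case False
        then have "Suc j < N" using that by simp
        then show ?thesis by (simp add: \<rho>_def Suc_diff_Suc)
      qed
    qed
    have "\<exists>\<pi>. (\<forall>l<2*k+1. \<pi> l < 2*k+1) \<and> (\<forall>i<s. \<forall>l<2*k+1.
      fst (h (glue i (\<rho> (\<pi> l)))) = l \<and> arc (h (glue i (\<rho> (\<pi> l)))) (h (glue i (\<rho> (\<pi> (Suc l mod (2*k+1)))))))"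
    proof (rule level_parametrisation[where c = "\<lambda>i j. h (glue i (\<rho> j))"])
      fix i j assume i: "i < s" and "j < 2 * k + 1"
      then have j: "j < N" by (simp add: N_def)
      have "Suc j mod N < N" using N by simp
      from down[OF i \<rho>(1)[OF this] nup[OF i \<rho>(1)[OF this]]]
      show "arc (h (glue i (\<rho> j))) (h (glue i (\<rho> (Suc j mod (2 * k + 1)))))"
        unfolding \<rho>(2)[OF j] by (simp add: N_def)
    next
      fix i
      have "\<rho> 0 = 0" by (simp add: \<rho>_def)
      then show "h (glue i (\<rho> 0)) = h (glue 0 (\<rho> 0))" by (simp add: glue_def)
    qed
    then obtain \<pi> where "\<forall>l<2*k+1. \<pi> l < 2*k+1" "\<forall>i<s. \<forall>l<2*k+1.
      fst (h (glue i (\<rho> (\<pi> l)))) = l \<and> arc (h (glue i (\<rho> (\<pi> l)))) (h (glue i (\<rho> (\<pi> (Suc l mod (2*k+1))))))"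
      by blast
    then show ?thesis using \<rho>(1) unfolding N_def by (intro exI[of _ "\<lambda>l. \<rho> (\<pi> l)"]) simp
  qed
qed

text \<open>A cycle of length \<open>2k + 1\<close> visits every level once, so it runs through exactly one path \<open>(\<cdot>, i, j)\<close>.
  The \<open>s\<close> cycles of a copy use different paths and can only share an edge between the levels \<open>0\<close> and
  \<open>2k\<close>, whose ends then agree in all \<open>s\<close> digits.\<close>

lemma gr_F_free: "F_free (F_graph s k) gr"
  unfolding F_free_def
proof
  assume "contains_copy (F_graph s k) gr"
  then obtain h where inj: "\<And>i j i' j'. i < s \<Longrightarrow> j < 2*k+1 \<Longrightarrow> i' < s \<Longrightarrow> j' < 2*k+1 \<Longrightarrow>
          h (glue i j) = h (glue i' j') \<Longrightarrow> glue i j = glue i' j'"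
    and emb: "\<And>i j. i < s \<Longrightarrow> j < 2*k+1 \<Longrightarrow> {h (glue i j), h (glue i (Suc j mod (2*k+1)))} \<in> edges gr"
    by (rule contains_copyE) blast
  obtain \<pi> where \<pi>N: "\<And>l. l < 2*k+1 \<Longrightarrow> \<pi> l < 2*k+1"
    and lev: "\<And>i l. i < s \<Longrightarrow> l < 2*k+1 \<Longrightarrow> fst (h (glue i (\<pi> l))) = l"
    and arcs: "\<And>i l. i < s \<Longrightarrow> l < 2*k+1 \<Longrightarrow> arc (h (glue i (\<pi> l))) (h (glue i (\<pi> (Suc l mod (2*k+1)))))"
    using copy_levels[OF emb] by blast
  define v where "v i l = h (glue i (\<pi> l))" for i l
  have inj\<pi>: "inj_on \<pi> {..<2*k+1}"
    by (rule inj_onI) (metis lev lessThan_iff s less_le_trans zero_less_numeral)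
  have surj: "\<pi> ` {..<2*k+1} = {..<2*k+1}"
    by (rule endo_inj_surj[OF _ _ inj\<pi>]) (use \<pi>N in auto)
  have v_lev: "fst (v i l) = l" if "i < s" "l < 2*k+1" for i l
    using lev[OF that] by (simp add: v_def)
  have arc_v: "arc (v i l) (v i (Suc l))" if "i < s" "l < 2*k" for i l
    using arcs[of i l] that by (simp add: v_def)
  have arc_last: "arc (v i (2*k)) (v i 0)" if "i < s" for i
    using arcs[of i "2*k"] that by (simp add: v_def)
  have shared: "v i l = v i' l \<longleftrightarrow> \<pi> l \<le> 1" if "i < s" "i' < s" "i \<noteq> i'" "l < 2*k+1" for i i' l
  proof
    assume "v i l = v i' l"
    then have "glue i (\<pi> l) = glue i' (\<pi> l)"
      unfolding v_def using inj that \<pi>N by blast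
    then show "\<pi> l \<le> 1" using that by (simp add: glue_eq_iff)
  next
    assume "\<pi> l \<le> 1"
    then show "v i l = v i' l" by (simp add: v_def glue_def)
  qed
  define P where "P i = fst (snd (v i 1))" for i
  define Q where "Q i = snd (snd (v i 1))" for i
  have path: "v i l = (l, P i, Q i)" if "i < s" "1 \<le> l" "l < 2*k" for i l
    using that(2,3)
  proof (induction l rule: dec_induct)
    case base
    then show ?case using v_lev[OF that(1), of 1] by (auto simp: P_def Q_def prod_eq_iff)
  next
    case (step l)
    then have "arc (l, P i, Q i) (v i (Suc l))" using arc_v[OF that(1), of l] by simp
    moreover have "fst (v i (Suc l)) = Suc l" using v_lev[OF that(1)] step by simp
    ultimately show ?case
      using step by (cases "v i (Suc l)") (auto simp: arc_def)
  qed
  define x where "x i = fst (snd (v i 0))" for i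
  define y where "y i = fst (snd (v i (2*k)))" for i
  have k1: "1 < 2 * k" "2 * k - 1 < 2 * k" "1 \<le> 2 * k - 1" "Suc (2 * k - 1) = 2 * k" using k by auto
  have x: "x i < M \<and> P i < s \<and> Q i = digit t (P i) (x i)" if "i < s" for i
    using arc_v[OF that, of 0] path[OF that _ k1(1)] v_lev[OF that, of 0] k
    by (cases "v i 0") (auto simp: arc_def x_def)
  have y: "y i < M \<and> Q i = digit t (P i) (y i)" if "i < s" for i
    using arc_v[OF that, of "2*k-1"] path[OF that k1(3,2)] v_lev[OF that, of "2*k"] k k1(4)
    by (cases "v i (2*k)") (auto simp: arc_def y_def)
  have nonadj: "\<not> same_cell s t M (x i) (y i)" if "i < s" for i
    using arc_last[OF that] v_lev[OF that, of 0] v_lev[OF that, of "2*k"] k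
    by (cases "v i 0"; cases "v i (2*k)") (auto simp: arc_def x_def y_def)
  have s01: "0 < s" "1 < s" using s by auto
  \<comment> \<open>A shared vertex on an inner level would make two cycles use the same path and
    hence share the levels \<open>1\<close>, \<open>2\<close> and \<open>3\<close>, while only two
    positions are shared.\<close>
  have mid: "\<pi> l \<ge> 2" if "1 \<le> l" "l < 2*k" for l
  proof (rule ccontr)
    assume "\<not> \<pi> l \<ge> 2"
    then have "v 0 l = v 1 l" using shared[OF s01, of l] that by simp
    then have "P 0 = P 1" "Q 0 = Q 1" using path[OF s01(1) that] path[OF s01(2) that] by auto
    then have "\<pi> l' \<le> 1" if "1 \<le> l'" "l' < 2*k" for l'
      using shared[OF s01, of l'] path[OF s01(1) that] path[OF s01(2) that] that by simp
    then have "\<pi> ` {1, 2, 3} \<subseteq> {0, 1}" using k by (auto simp: le_Suc_eq)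
    moreover have "inj_on \<pi> {1, 2, 3}" by (rule inj_on_subset[OF inj\<pi>]) (use k in auto)
    ultimately have "card {1, 2, 3 :: nat} \<le> card {0, 1 :: nat}"
      by (intro card_inj_on_le[of \<pi>]) auto
    then show False by simp
  qed
  \<comment> \<open>By elimination the shared positions \<open>0\<close> and \<open>1\<close> belong
    to the levels \<open>0\<close> and \<open>2 * k\<close>, so all cycles have the same
    \<open>x\<close> and the same \<open>y\<close>.\<close>
  have ends: "\<pi> 0 \<le> 1" "\<pi> (2*k) \<le> 1"
  proof -
    have "0 \<in> \<pi> ` {..<2*k+1}" "1 \<in> \<pi> ` {..<2*k+1}" unfolding surj using k by auto
    then obtain l l' where l: "l < 2*k+1" "\<pi> l = 0" "l' < 2*k+1" "\<pi> l' = 1"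
      unfolding image_iff Bex_def lessThan_iff by metis
    then have "\<not> (1 \<le> l \<and> l < 2*k)" "\<not> (1 \<le> l' \<and> l' < 2*k)"
      using mid[of l] mid[of l'] by auto
    then have "l = 0 \<or> l = 2*k" "l' = 0 \<or> l' = 2*k" using l by linarith+
    moreover have "l \<noteq> l'" using l by auto
    ultimately show "\<pi> 0 \<le> 1" "\<pi> (2*k) \<le> 1" using l by auto
  qed
  have const: "x i = x 0" "y i = y 0" if "i < s" for i
    using shared[OF that s01(1), of 0] shared[OF that s01(1), of "2*k"] ends
    unfolding x_def y_def by (cases "i = 0"; simp)+
  \<comment> \<open>Two cycles with the same coordinate would read the same digit of the common
    \<open>x 0\<close> and hence use the same path. So all \<open>s\<close> coordinates occur, and
    \<open>x 0\<close> and \<open>y 0\<close> agree in every digit although their vertices are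
    adjacent.\<close>
  have "inj_on P {..<s}"
  proof (rule inj_onI, rule ccontr)
    fix i i' assume i: "i \<in> {..<s}" "i' \<in> {..<s}" "P i = P i'" "i \<noteq> i'"
    then have "Q i = Q i'" using x[of i] x[of i'] const[of i] const[of i'] by simp
    then have "v i 1 = v i' 1" using path[of i 1] path[of i' 1] i k1 by simp
    then have "\<pi> 1 \<le> 1" using shared[of i i' 1] i k1 by simp
    then show False using mid[of 1] k1 by simp
  qed
  then have P_surj: "P ` {..<s} = {..<s}"
    by (rule endo_inj_surj[rotated 2]) (use x in auto)
  have "digit t p (x 0) = digit t p (y 0)" if "p < s" for p
  proof -
    have "p \<in> P ` {..<s}" unfolding P_surj using that by simp
    then obtain i where "i < s" "P i = p" by (elim imageE) simp
    then show ?thesis using x[of i] y[of i] const[of i] by metis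
  qed
  moreover have "x 0 < M" "y 0 < M" using x[OF s01(1)] y[OF s01(1)] by blast+
  ultimately show False using nonadj[OF s01(1)] unfolding same_cell_def by blast
qed

end

section \<open>Relabelling and extension to a maximal graph\<close>

definition image_graph :: "('a \<Rightarrow> 'b) \<Rightarrow> 'a sgraph \<Rightarrow> 'b sgraph" where
  "image_graph f G = (f ` verts G, (\<lambda>e. f ` e) ` edges G)"

lemma simple_image_graph:
  assumes "inj f" "simple_graph G"
  shows "simple_graph (image_graph f G)"
  using assms by (auto simp: simple_graph_def image_graph_def card_image inj_on_subset)

lemma card_image_graph:
  assumes "inj f"
  shows "card (verts (image_graph f G)) = card (verts G)" "card (edges (image_graph f G)) = card (edges G)"
proof -
  show "card (verts (image_graph f G)) = card (verts G)"
    unfolding image_graph_def using assms by (simp add: card_image inj_on_subset)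
  have "inj_on (\<lambda>e. f ` e) (edges G)" using assms by (simp add: inj_on_def inj_image_eq_iff)
  then show "card (edges (image_graph f G)) = card (edges G)"
    unfolding image_graph_def by (simp add: card_image)
qed

lemma F_free_image_graph:
  assumes "inj f" "F_free F G"
  shows "F_free F (image_graph f G)"
  unfolding F_free_def
proof
  assume "contains_copy F (image_graph f G)"
  then obtain h where h: "inj_on h (verts F)" "h ` verts F \<subseteq> f ` verts G"
    "\<forall>e\<in>edges F. h ` e \<in> (\<lambda>e. f ` e) ` edges G"
    by (auto simp: contains_copy_def image_graph_def)
  have "contains_copy F G"
    unfolding contains_copy_def
  proof (intro exI conjI ballI)
    have "inj_on (inv f) (h ` verts F)" using h(2) by (meson image_mono inj_on_inv_into inj_on_subset subset_UNIV)
    then show "inj_on (inv f \<circ> h) (verts F)" using h(1) by (rule comp_inj_on[rotated])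
    have "inv f ` h ` verts F \<subseteq> inv f ` f ` verts G" using h(2) by (rule image_mono)
    then show "(inv f \<circ> h) ` verts F \<subseteq> verts G"
      using assms(1) by (simp only: image_comp[symmetric] image_inv_f_f)
    fix e assume "e \<in> edges F"
    then have "h ` e \<in> (\<lambda>e. f ` e) ` edges G" using h(3) by (rule bspec[rotated])
    then obtain e' where "e' \<in> edges G" "h ` e = f ` e'" by (elim imageE) (rule that)
    moreover from this have "(inv f \<circ> h) ` e = e'"
      using assms(1) by (simp only: image_comp[symmetric] image_inv_f_f)
    ultimately show "(inv f \<circ> h) ` e \<in> edges G" by simp
  qed
  then show False using assms(2) by (simp add: F_free_def)
qed

lemma ex_maximal_extension:
  assumes G: "simple_graph G" "F_free F G"
  shows "\<exists>H. simple_graph H \<and> verts H = verts G \<and> edges G \<subseteq> edges H \<and> maximal_F_free F H"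
proof -
  define \<E> where "\<E> = {E. edges G \<subseteq> E \<and> simple_graph (verts G, E) \<and> F_free F (verts G, E)}"
  have "\<E> \<subseteq> Pow (Pow (verts G))" by (auto simp: \<E>_def simple_graph_def)
  moreover have "finite (Pow (Pow (verts G)))" using G(1) by (simp add: simple_graph_def)
  ultimately have "finite \<E>" by (rule finite_subset)
  moreover have "edges G \<in> \<E>" using G by (simp add: \<E>_def)
  ultimately obtain E where E: "E \<in> \<E>" and max: "\<And>E'. E' \<in> \<E> \<Longrightarrow> E \<subseteq> E' \<Longrightarrow> E' = E"
    using finite_has_maximal[of \<E>] by (metis empty_iff)
  have "maximal_F_free F (verts G, E)"
    unfolding maximal_F_free_def
  proof (intro conjI ballI impI)
    show "F_free F (verts G, E)" using E by (simp add: \<E>_def)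
    fix u v assume uv: "u \<in> verts (verts G, E)" "v \<in> verts (verts G, E)" "u \<noteq> v" "{u, v} \<notin> edges (verts G, E)"
    show "contains_copy F (add_edge {u, v} (verts G, E))"
    proof (rule ccontr)
      assume "\<not> ?thesis"
      then have "F_free F (verts G, insert {u, v} E)" by (simp add: F_free_def add_edge_def)
      then have "insert {u, v} E \<in> \<E>" using E uv by (auto simp: \<E>_def simple_graph_def)
      from max[OF this] uv(4) show False by auto
    qed
  qed
  then show ?thesis using E by (intro exI[of _ "(verts G, E)"]) (auto simp: \<E>_def)
qed

text \<open>The ends of a walk of three edges lie in opposite parts.\<close>

lemma complete_bipartite_path:
  assumes "complete_bipartite H" "{x, y} \<in> edges H" "{z, y} \<in> edges H" "{z, w} \<in> edges H"
  shows "{x, w} \<in> edges H"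
proof -
  obtain A B where AB: "A \<inter> B = {}" "edges H = {{a, b} | a b. a \<in> A \<and> b \<in> B}"
    using assms(1) unfolding complete_bipartite_def by (elim exE conjE) (rule that)
  have *: "{p, q} \<in> edges H \<longleftrightarrow> p \<in> A \<and> q \<in> B \<or> p \<in> B \<and> q \<in> A" for p q
    unfolding AB(2) by (auto simp: doubleton_eq_iff)
  show ?thesis using assms(2-4) AB(1) unfolding * by blast
qed

context gadget
begin

text \<open>The digits of \<open>x\<close> select \<open>s\<close> disjoint paths between the two
  vertices of index \<open>x\<close>, so an edge between these completes a copy. As \<open>H\<close>
  may have further edges, the pair stays nonadjacent in every \<open>F\<close>-free
  extension.\<close>

lemma copy_through_cell:
  assumes f: "inj f" and x: "x < M" and "f ` V \<subseteq> verts H" "(\<lambda>e. f ` e) ` edges gr \<subseteq> edges H"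
    and e: "{f (2 * k, x, 0), f (0, x, 0)} \<in> edges H"
  shows "contains_copy (F_graph s k) H"
proof -
  \<comment> \<open>\<open>g i\<close> is the directed route from level \<open>0\<close> to level
    \<open>2 * k\<close> through the path that the \<open>i\<close>-th digit of \<open>x\<close>
    selects.\<close>
  define g where "g i l = (if l = 0 then (0, x, 0) else if l = 2 * k then (2 * k, x, 0) else (l, i, digit t i x))" for i l
  let ?P = "\<lambda>i. map (\<lambda>l. f (g i l)) [1..<2*k]"
  have dt: "digit t i x < t" for i using t by (simp add: digit_def)
  have arc_g: "arc (g i l) (g i (Suc l))" if "i < s" "l < 2 * k" for i l
    using that x k dt by (auto simp: arc_def g_def)
  have arc_H: "{f u, f v} \<in> edges H" if "arc u v" for u v
  proof -
    have "{u, v} \<in> edges gr" unfolding gr_def snd_conv using that by blast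
    then have "f ` {u, v} \<in> edges H" using assms(4) by blast
    then show ?thesis by simp
  qed
  have inV: "g i l \<in> V" if "i < s" "l < 2 * k" for i l using arc_verts(1)[OF arc_g[OF that]] .
  show ?thesis
  proof (rule contains_copy_of_paths[where u = "f (2 * k, x, 0)" and v = "f (0, x, 0)" and P = ?P])
    show "k \<ge> 1" using k by simp
    show "{f (2 * k, x, 0), f (0, x, 0)} \<in> edges H" by (rule e)
    show "f (2 * k, x, 0) \<noteq> f (0, x, 0)" using inj_eq[OF f] k by simp
    have "(2 * k, x, 0) \<in> V" "(0, x, 0) \<in> V" using x M_le k by (auto simp: V_def)
    then show "f (2 * k, x, 0) \<in> verts H" "f (0, x, 0) \<in> verts H" using assms(3) by auto
  next
    fix i assume i: "i < s"
    have "distinct (?P i)"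
      unfolding distinct_map using inj_eq[OF f] by (auto simp: inj_on_def g_def split: if_splits)
    moreover have "set (?P i) \<subseteq> verts H - {f (2 * k, x, 0), f (0, x, 0)}"
    proof
      fix w assume "w \<in> set (?P i)"
      then obtain l where l: "w = f (g i l)" "1 \<le> l" "l < 2 * k" by auto
      then show "w \<in> verts H - {f (2 * k, x, 0), f (0, x, 0)}"
        using inV[OF i l(3)] assms(3) inj_eq[OF f] by (auto simp: g_def)
    qed
    moreover have "successively (\<lambda>x y. {x, y} \<in> edges H) (f (0, x, 0) # ?P i @ [f (2 * k, x, 0)])"
    proof -
      have "[0..<Suc (2 * k)] = 0 # [1..<2*k] @ [2*k]"
        using k by (simp add: upt_conv_Cons)
      then have "f (0, x, 0) # ?P i @ [f (2 * k, x, 0)] = map (\<lambda>l. f (g i l)) [0..<Suc (2 * k)]"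
        using k by (simp add: g_def)
      moreover have "successively (\<lambda>l l'. {f (g i l), f (g i l')} \<in> edges H) [0..<Suc (2 * k)]"
        unfolding successively_conv_nth
      proof (intro allI impI)
        fix l assume "Suc l < length [0..<Suc (2 * k)]"
        then have "l < 2 * k" by simp
        then show "{f (g i ([0..<Suc (2 * k)] ! l)), f (g i ([0..<Suc (2 * k)] ! Suc l))} \<in> edges H"
          using arc_H[OF arc_g[OF i]] by (simp del: upt_Suc)
      qed
      ultimately show ?thesis by (simp only: successively_map)
    qed
    ultimately show "length (?P i) = 2 * k - 1 \<and> distinct (?P i) \<and>
        set (?P i) \<subseteq> verts H - {f (2 * k, x, 0), f (0, x, 0)} \<and>
        successively (\<lambda>x y. {x, y} \<in> edges H) (f (0, x, 0) # ?P i @ [f (2 * k, x, 0)])"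
      by simp
  next
    fix i i' :: nat assume "i \<noteq> i'"
    then show "set (?P i) \<inter> set (?P i') = {}"
      using inj_eq[OF f] by (auto simp: g_def)
  qed
qed

text \<open>If fewer vertices were missing, \<open>S\<close> would contain both vertices of some
  index \<open>x < M\<close> and in each part a vertex of index at least \<open>M\<close>. The
  latter are adjacent to all of the opposite part, so a path of three edges in \<open>S\<close>
  joins the nonadjacent pair of index \<open>x\<close>.\<close>

lemma ex_maximal_graph:
  assumes "a \<le> b"
  shows "\<exists>G :: nat sgraph. graph_on (card V) G \<and> maximal_F_free (F_graph s k) G \<and>
    a * b \<le> card (edges G) + M * m \<and>
    (\<forall>S\<subseteq>verts G. complete_bipartite (induced G S) \<longrightarrow> card S + min M (a - M) \<le> card V)"
proof -
  define f :: "nat \<times> nat \<times> nat \<Rightarrow> nat" where "f = to_nat"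
  have f: "inj f" by (simp add: f_def)
  let ?G = "image_graph f gr"
  have vG: "verts ?G = f ` V" and eG: "edges ?G = (\<lambda>e. f ` e) ` edges gr"
    by (simp_all add: image_graph_def gr_def)
  obtain H where H: "simple_graph H" "verts H = f ` V" "edges ?G \<subseteq> edges H" "maximal_F_free (F_graph s k) H"
    using ex_maximal_extension[OF simple_image_graph[OF f simple_gr] F_free_image_graph[OF f gr_F_free]] vG by auto
  have cV: "card (verts H) = card V" using H(2) f by (simp add: card_image inj_on_subset)
  have finV: "finite (verts H)" using H(1) by (simp add: simple_graph_def)
  have "card (edges gr) \<le> card (edges H)"
    using card_mono[OF finite_edges[OF H(1)] H(3)] card_image_graph(2)[OF f, of gr] by simp
  then have edges: "a * b \<le> card (edges H) + M * m" using card_edges_gr by linarith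
  have adj: "{f (0, x, 0), f (2 * k, y, 0)} \<in> edges H"
    if "x < a" "y < b" "\<not> same_cell s t M x y" for x y
  proof -
    have "arc (2 * k, y, 0) (0, x, 0)" using that by (simp add: arc_def)
    then have "{(2 * k, y, 0), (0, x, 0)} \<in> edges gr" unfolding gr_def snd_conv by blast
    then have "f ` {(2 * k, y, 0), (0, x, 0)} \<in> edges H" using H(3) eG by blast
    then show ?thesis by (simp add: insert_commute)
  qed
  have nonadj: "{f (0, x, 0), f (2 * k, x, 0)} \<notin> edges H" if "x < M" for x
  proof
    assume "{f (0, x, 0), f (2 * k, x, 0)} \<in> edges H"
    then have "contains_copy (F_graph s k) H"
      using H(2,3) eG by (intro copy_through_cell[OF f that]) (simp_all add: insert_commute)
    then show False using H(4) by (simp add: maximal_F_free_def F_free_def)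
  qed
  have "card S + min M (a - M) \<le> card V" if S: "S \<subseteq> verts H" "complete_bipartite (induced H S)" for S
  proof (rule ccontr)
    assume "\<not> ?thesis"
    moreover have "card (verts H - S) = card V - card S"
      using S(1) finV cV by (simp add: card_Diff_subset finite_subset)
    moreover have "card S \<le> card V" using card_mono[OF finV S(1)] cV by simp
    ultimately have miss: "card (verts H - S) < M" "card (verts H - S) < a - M" by linarith+
    have hits: "\<exists>x\<in>I. g x \<in> S" if "inj_on g I" "g ` I \<subseteq> verts H" "card (verts H - S) < card I"
      for g :: "nat \<Rightarrow> nat" and I
    proof (rule ccontr)
      assume "\<not> ?thesis"
      then have "g ` I \<subseteq> verts H - S" using that(2) by auto
      then have "card I \<le> card (verts H - S)" using that(1) finV by (intro card_inj_on_le) auto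
      then show False using that(3) by simp
    qed
    have inV: "(0, x, 0) \<in> V" if "x < a" for x using that by (simp add: V_def)
    have inV': "(2 * k, y, 0) \<in> V" if "y < b" for y using that by (simp add: V_def)
    have injs: "inj_on (\<lambda>x. f (0, x, 0)) I" "inj_on (\<lambda>x. f (2 * k, x, 0)) I" for I
      using inj_eq[OF f] by (simp_all add: inj_on_def)
    have "\<exists>x\<in>{M..<a}. f (0, x, 0) \<in> S"
      using miss(2) inV H(2) by (intro hits injs) auto
    then obtain x' where x': "M \<le> x'" "x' < a" "f (0, x', 0) \<in> S" by auto
    have "\<exists>y\<in>{M..<b}. f (2 * k, y, 0) \<in> S"
      using miss(2) inV' H(2) assms by (intro hits injs) auto
    then obtain y' where y': "M \<le> y'" "y' < b" "f (2 * k, y', 0) \<in> S" by auto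
    \<comment> \<open>\<open>g\<close> selects a vertex outside \<open>S\<close> from the pair of
      index \<open>x\<close> unless both lie in \<open>S\<close>; by injectivity and the small
      number of missing vertices some pair lies in \<open>S\<close> entirely.\<close>
    define g where "g x = (if f (0, x, 0) \<in> S then f (2 * k, x, 0) else f (0, x, 0))" for x
    have "\<exists>x<M. f (0, x, 0) \<in> S \<and> f (2 * k, x, 0) \<in> S"
    proof -
      have "inj_on g {..<M}" using inj_eq[OF f] k by (simp add: g_def inj_on_def)
      moreover have "g ` {..<M} \<subseteq> verts H" using M_le inV inV' H(2) by (auto simp: g_def)
      ultimately have "\<exists>x\<in>{..<M}. g x \<in> S" using miss(1) by (intro hits) auto
      then show ?thesis by (auto simp: g_def split: if_splits)
    qed
    then obtain x where x: "x < M" "f (0, x, 0) \<in> S" "f (2 * k, x, 0) \<in> S" by blast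
    have "\<not> same_cell s t M x y'" "\<not> same_cell s t M x' y'" "\<not> same_cell s t M x' x"
      using x' y' by (simp_all add: same_cell_def)
    then have "{f (0, x, 0), f (2 * k, y', 0)} \<in> edges H" "{f (0, x', 0), f (2 * k, y', 0)} \<in> edges H"
      "{f (0, x', 0), f (2 * k, x, 0)} \<in> edges H"
      using adj[of x y'] adj[of x' y'] adj[of x' x] x(1) x'(2) y'(2) M_le by simp_all
    then have "{f (0, x, 0), f (2 * k, y', 0)} \<in> edges (induced H S)"
      "{f (0, x', 0), f (2 * k, y', 0)} \<in> edges (induced H S)"
      "{f (0, x', 0), f (2 * k, x, 0)} \<in> edges (induced H S)"
      using x(2,3) x'(3) y'(3) by (simp_all add: edges_induced)
    then have "{f (0, x, 0), f (2 * k, x, 0)} \<in> edges (induced H S)"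
      by (rule complete_bipartite_path[OF S(2)])
    then show False using nonadj[OF x(1)] by (simp add: edges_induced)
  qed
  then show ?thesis using H(1,4) cV edges by (intro exI[of _ H]) (simp add: graph_on_def)
qed

end

lemma nat_floor_bounds:
  fixes x :: real
  assumes "x \<ge> 2"
  shows "x / 2 \<le> real (nat \<lfloor>x\<rfloor>)" "real (nat \<lfloor>x\<rfloor>) \<le> x" "1 \<le> nat \<lfloor>x\<rfloor>"
proof -
  have "real (nat \<lfloor>x\<rfloor>) = of_int \<lfloor>x\<rfloor>" using assms by simp
  then show "x / 2 \<le> real (nat \<lfloor>x\<rfloor>)" "real (nat \<lfloor>x\<rfloor>) \<le> x" "1 \<le> nat \<lfloor>x\<rfloor>"
    using assms floor_correct[of x] by linarith+
qed

section \<open>Choice of the parameters\<close>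

text \<open>With \<open>t\<close> and \<open>m\<close> about \<open>\<tau> * p\<close> and
  \<open>\<mu> * p\<close>, the number \<open>m * t ^ s\<close> is a constant proportion of
  \<open>n\<close>, while there are \<open>O(p)\<close> path vertices and \<open>O(n p)\<close>
  missing pairs, both with small constants.\<close>

lemma tightness:
  fixes k s :: nat and \<gamma> :: real
  assumes k: "k \<ge> 2" and s: "s \<ge> 2" and \<gamma>: "\<gamma> > 0"
  shows "\<exists>\<beta>::real. \<beta> > 0 \<and> (\<exists>n0::nat. \<forall>n\<ge>n0. \<exists>G::nat sgraph.
    graph_on n G \<and> maximal_F_free (F_graph s k) G \<and>
    real (card (edges G)) \<ge> real (ex_number n (F_graph s k))
        - \<gamma> * real n powr ((real s + 2) / (real s + 1)) \<and>
    (\<forall>S\<subseteq>verts G. complete_bipartite (induced G S) \<longrightarrow> real (card S) \<le> (1 - \<beta>) * real n))"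
proof -
  define \<delta> where "\<delta> = min \<gamma> 1"
  have \<delta>: "0 < \<delta>" "\<delta> \<le> 1" "\<delta> \<le> \<gamma>" using \<gamma> by (auto simp: \<delta>_def)
  \<comment> \<open>\<open>\<tau>\<close> keeps the number of path vertices at most
    \<open>\<delta> * p / 8\<close>, and \<open>\<mu>\<close> the number of missing pairs at most
    \<open>\<delta> * n * p / 256\<close>.\<close>
  define \<tau> where "\<tau> = \<delta> / (16 * real k * real s)"
  define \<mu> where "\<mu> = \<delta> / 2"
  have ks: "4 \<le> real k * real s" using mult_mono[of 2 "real k" 2 "real s"] k s by simp
  have \<tau>0: "0 < \<tau>" using \<delta> k s by (simp add: \<tau>_def)
  have \<tau>ks: "16 * real k * real s * \<tau> = \<delta>" using k s by (simp add: \<tau>_def)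
  have "\<tau> * 4 \<le> \<tau> * (real k * real s)" using ks \<tau>0 by (intro mult_left_mono) auto
  then have \<tau>1: "\<tau> \<le> 1 / 64" using \<tau>ks \<delta>(2) by (simp add: algebra_simps)
  have \<mu>: "0 < \<mu>" "\<mu> \<le> 1 / 2" using \<delta> by (auto simp: \<mu>_def)
  \<comment> \<open>The halvings pay for rounding down: the floor of a number at least
    \<open>2\<close> is at least half of it. The bound \<open>p0\<close> below ensures that
    \<open>\<tau> * p\<close> and \<open>\<mu> * p\<close> are that large.\<close>
  define \<beta> where "\<beta> = (\<mu> / 2) * (\<tau> / 2) ^ s"
  have \<beta>0: "\<beta> > 0" using \<mu> \<tau>0 by (simp add: \<beta>_def)
  have pow1: "x ^ s \<le> x" if "0 \<le> x" "x \<le> 1" for x :: real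
    using power_decreasing[of 1 s x] that s by simp
  have \<tau>s: "\<tau> ^ s \<le> 1 / 64" using pow1[of \<tau>] \<tau>0 \<tau>1 by linarith
  have \<beta>1: "\<beta> \<le> 1 / 4"
  proof -
    have "(\<tau> / 2) ^ s \<le> 1" using pow1[of "\<tau> / 2"] \<tau>0 \<tau>1 by linarith
    then have "\<beta> \<le> (1 / 4) * 1" unfolding \<beta>_def using \<mu> \<tau>0 by (intro mult_mono) auto
    then show ?thesis by simp
  qed
  define p0 where "p0 = max (2 / \<tau>) (2 / \<mu>)"
  have p0: "p0 > 0" using \<tau>0 by (simp add: p0_def less_max_iff_disj)
  define n0 where "n0 = max (800 + 30 * (100 * (2 * k * s + 2 * k + 10)))
    (max (nat \<lceil>1 / (2 * \<delta>)\<rceil>) (nat \<lceil>p0 ^ s * p0\<rceil>))"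
  show ?thesis
  proof (rule exI[of _ \<beta>], rule conjI[OF \<beta>0], rule exI[of _ n0], intro allI impI)
    fix n :: nat
    assume n: "n0 \<le> n"
    have n1: "n \<ge> 800 + 30 * (100 * (2 * k * s + 2 * k + 10))"
      "nat \<lceil>1 / (2 * \<delta>)\<rceil> \<le> n" "nat \<lceil>p0 ^ s * p0\<rceil> \<le> n"
      using n unfolding n0_def by (auto simp only: max.bounded_iff)
    have n2: "1 / (2 * \<delta>) \<le> real n" "p0 ^ s * p0 \<le> real n"
      using n1(2,3) by (simp_all only: nat_le_iff ceiling_le_iff of_int_of_nat_eq)
    have n3: "1 / 2 \<le> \<delta> * real n" using n2(1) \<delta>(1) by (simp add: field_simps)
    define x where "x = real n"
    have x: "x \<ge> 800" using n1(1) by (simp add: x_def)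
    define p where "p = real n powr (1 / (real s + 1))"
    have "1 \<le> n" "1 \<le> s" using n1(1) s by auto
    note p = powr_root_facts[OF this, folded p_def x_def]
    have px: "p \<le> x"
    proof -
      have "p * 1 \<le> p * p" using p(1) by (intro mult_left_mono) auto
      then show ?thesis using p(4) by simp
    qed
    have "p0 \<le> p"
    proof (rule ccontr)
      assume "\<not> p0 \<le> p"
      then have "p ^ Suc s < p0 ^ Suc s" using p(1) by (intro power_strict_mono) auto
      then show False using n2(2) p(2) by (simp add: x_def mult.commute)
    qed
    then have "2 / \<tau> \<le> p" "2 / \<mu> \<le> p" by (simp_all add: p0_def)
    then have ge2: "2 \<le> \<tau> * p" "2 \<le> \<mu> * p" using \<tau>0 \<mu>(1) by (simp_all add: field_simps)
    define t where "t = nat \<lfloor>\<tau> * p\<rfloor>"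
    define m where "m = nat \<lfloor>\<mu> * p\<rfloor>"
    note t = nat_floor_bounds[OF ge2(1), folded t_def]
    note m = nat_floor_bounds[OF ge2(2), folded m_def]
    define q where "q = (2 * k - 1) * (s * t)"
    define M where "M = m * t ^ s"
    have "real q \<le> 2 * real k * (real s * real t)"
      unfolding q_def of_nat_mult by (intro mult_right_mono) auto
    also have "\<dots> \<le> 2 * real k * (real s * (\<tau> * p))" using t(2) by (intro mult_left_mono) auto
    also have "\<dots> = \<delta> * p / 8" using \<tau>ks by (simp add: algebra_simps)
    finally have q: "real q \<le> \<delta> * p / 8" .
    have "\<delta> * p \<le> 1 * p" using \<delta> p(1) by (intro mult_right_mono) auto
    then have qx: "real q \<le> x / 8" using q px by simp
    have psx: "p ^ s * p = x" using p(2) .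
    have "real M \<le> (\<mu> * p) * (\<tau> * p) ^ s"
      unfolding M_def using t m \<mu> \<tau>0 p(1) by (simp add: mult_mono power_mono)
    also have "\<dots> = \<mu> * \<tau> ^ s * (p ^ s * p)" by (simp add: power_mult_distrib)
    also have "\<dots> \<le> (1 / 2) * (1 / 64) * x"
      unfolding psx using \<mu> \<tau>s \<tau>0 x by (intro mult_right_mono mult_mono) auto
    finally have M_up: "real M \<le> x / 128" by simp
    have "\<beta> * x = (\<mu> * p / 2) * (\<tau> * p / 2) ^ s"
      unfolding \<beta>_def psx[symmetric] by (simp add: power_mult_distrib power_divide)
    also have "\<dots> \<le> real m * real t ^ s"
      using t m ge2 by (intro mult_mono power_mono) auto
    finally have M_low: "\<beta> * x \<le> real M" by (simp add: M_def)
    define r where "r = n - q"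
    have qn: "q \<le> n" using qx x by (simp add: x_def)
    then have r: "real r = x - real q" by (simp add: r_def x_def of_nat_diff)
    define a where "a = r div 2"
    define b where "b = r - r div 2"
    have ab: "a + b = r" "a \<le> b" by (auto simp: a_def b_def)
    have "2 * a + 1 \<ge> r" by (simp add: a_def)
    then have "2 * real a + 1 \<ge> real r" by linarith
    then have a_low: "real a \<ge> x * (7 / 16) - 1 / 2" using r qx by (simp add: field_simps)
    then have "real M \<le> real a" using M_up x by linarith
    then have Ma: "M \<le> a" by simp
    have "\<beta> * x \<le> 1 / 4 * x" using \<beta>1 x by (intro mult_right_mono) auto
    moreover have "real (a - M) = real a - real M" using Ma by (rule of_nat_diff)
    ultimately have "\<beta> * x \<le> real (a - M)" using a_low M_up x by linarith
    then have min_low: "\<beta> * x \<le> real (min M (a - M))" using M_low by (simp add: min_def)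
    interpret gadget s t m k a b
      by unfold_locales (use k s t(3) Ma ab(2) in \<open>auto simp: M_def\<close>)
    have "card V = n" using card_V ab(1) qn by (simp add: q_def r_def)
    then obtain G :: "nat sgraph" where G: "graph_on n G" "maximal_F_free (F_graph s k) G"
      "a * b \<le> card (edges G) + M * m"
      "\<forall>S\<subseteq>verts G. complete_bipartite (induced G S) \<longrightarrow> card S + min M (a - M) \<le> n"
      using ex_maximal_graph[OF ab(2)] unfolding M_def by auto
    have "(real r ^ 2 - 1) / 4 \<le> real (a * b)" unfolding a_def b_def by (rule balanced_product_ge)
    also have "\<dots> \<le> real (card (edges G) + M * m)" using G(3) by (rule of_nat_mono)
    finally have e1: "(real r ^ 2 - 1) / 4 \<le> real (card (edges G)) + real M * real m" by simp
    have e2: "real r ^ 2 \<ge> x ^ 2 - 2 * (x * real q)" unfolding r by (simp add: power2_eq_square algebra_simps)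
    have e3: "x * real q \<le> \<delta> * (x * p) / 8"
      using mult_left_mono[OF q, of x] x by (simp add: algebra_simps)
    have "real M * real m \<le> (x / 128) * (\<mu> * p)" using M_up m x by (intro mult_mono) auto
    then have e4: "real M * real m \<le> \<delta> * (x * p) / 256" by (simp add: \<mu>_def algebra_simps)
    have "\<delta> * x * 1 \<le> \<delta> * x * p" using p(1) \<delta>(1) x by (intro mult_left_mono) auto
    then have e5: "1 / 2 \<le> \<delta> * (x * p)" using n3 unfolding x_def[symmetric] by (simp add: mult.assoc)
    have "\<delta> * (x * p) \<le> \<gamma> * (x * p)" using \<delta>(3) x p(1) by (intro mult_right_mono) auto
    moreover have "real (ex_number n (F_graph s k)) \<le> x ^ 2 / 4"
      using ex_number_upper[OF \<open>1 \<le> s\<close> k n1(1)] by (simp add: x_def)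
    \<comment> \<open>The losses against \<open>x^2 / 4\<close> are at most
      \<open>\<delta> * x * p\<close> times \<open>1 / 16\<close> for the path vertices,
      \<open>1 / 256\<close> for the missing pairs and \<open>1 / 2\<close> for parity.\<close>
    ultimately have "real (ex_number n (F_graph s k)) - \<gamma> * (x * p) \<le> real (card (edges G))"
      using e1 e2 e3 e4 e5 by (simp add: field_simps)
    then have edges: "real (ex_number n (F_graph s k)) - \<gamma> * real n powr ((real s + 2) / (real s + 1))
        \<le> real (card (edges G))"
      using p(3) by (simp add: x_def)
    have "real (card S) \<le> (1 - \<beta>) * real n" if "S \<subseteq> verts G" "complete_bipartite (induced G S)" for S
    proof -
      have "card S + min M (a - M) \<le> n" using G(4) that by blast
      then have "real (card S) + real (min M (a - M)) \<le> real n" by linarith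
      then show ?thesis using min_low by (simp add: x_def algebra_simps)
    qed
    then show "\<exists>G::nat sgraph. graph_on n G \<and> maximal_F_free (F_graph s k) G \<and>
      real (ex_number n (F_graph s k)) - \<gamma> * real n powr ((real s + 2) / (real s + 1)) \<le> real (card (edges G)) \<and>
      (\<forall>S\<subseteq>verts G. complete_bipartite (induced G S) \<longrightarrow> real (card S) \<le> (1 - \<beta>) * real n)"
      using G(1,2) edges by blast
  qed
qed

theorem theorem1p5:
  fixes k s :: nat
  assumes "k \<ge> 2" and "s \<ge> 2"
  shows
    "(\<forall>\<beta>::real. \<beta> > 0 \<longrightarrow> (\<exists>\<gamma>::real. \<gamma> > 0 \<and> (\<exists>n0::nat. \<forall>n\<ge>n0. \<forall>G::nat sgraph.
        graph_on n G \<longrightarrow> maximal_F_free (F_graph s k) G \<longrightarrow>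
        real (card (edges G)) \<ge> real (ex_number n (F_graph s k))
            - \<gamma> * real n powr ((real s + 2) / (real s + 1)) \<longrightarrow>
        (\<exists>S\<subseteq>verts G. complete_bipartite (induced G S) \<and>
            real (card S) \<ge> (1 - \<beta>) * real n))))
     \<and>
     (\<forall>\<gamma>::real. \<gamma> > 0 \<longrightarrow> (\<exists>\<beta>::real. \<beta> > 0 \<and> (\<exists>n0::nat. \<forall>n\<ge>n0. \<exists>G::nat sgraph.
        graph_on n G \<and> maximal_F_free (F_graph s k) G \<and>
        real (card (edges G)) \<ge> real (ex_number n (F_graph s k))
            - \<gamma> * real n powr ((real s + 2) / (real s + 1)) \<and>
        (\<forall>S\<subseteq>verts G. complete_bipartite (induced G S) \<longrightarrow>
            real (card S) \<le> (1 - \<beta>) * real n))))"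
proof (rule conjI; intro allI impI)
  fix \<beta> :: real
  assume "\<beta> > 0"
  moreover have "s \<ge> 1" using assms(2) by simp
  ultimately show "\<exists>\<gamma>::real. \<gamma> > 0 \<and> (\<exists>n0::nat. \<forall>n\<ge>n0. \<forall>G::nat sgraph.
        graph_on n G \<longrightarrow> maximal_F_free (F_graph s k) G \<longrightarrow>
        real (card (edges G)) \<ge> real (ex_number n (F_graph s k))
            - \<gamma> * real n powr ((real s + 2) / (real s + 1)) \<longrightarrow>
        (\<exists>S\<subseteq>verts G. complete_bipartite (induced G S) \<and>
            real (card S) \<ge> (1 - \<beta>) * real n))"
    by (intro stability[OF assms(1)])
next
  fix \<gamma> :: real
  assume "\<gamma> > 0"
  then show "\<exists>\<beta>::real. \<beta> > 0 \<and> (\<exists>n0::nat. \<forall>n\<ge>n0. \<exists>G::nat sgraph.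
        graph_on n G \<and> maximal_F_free (F_graph s k) G \<and>
        real (card (edges G)) \<ge> real (ex_number n (F_graph s k))
            - \<gamma> * real n powr ((real s + 2) / (real s + 1)) \<and>
        (\<forall>S\<subseteq>verts G. complete_bipartite (induced G S) \<longrightarrow>
            real (card S) \<le> (1 - \<beta>) * real n))"
    by (rule tightness[OF assms])
qed

end
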